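(* Let $n\ge 1$. There exists a constant $c_n>0$ depending only on $n$ such that the following holds. Let $\alpha\in(0,n)$, $1\le p<\frac{n}{\alpha}$, $1\le r\le p$ and $w\in A_r$, and put $p^*_\alpha=\frac{np}{n-\alpha p}$. If $r>1$, let $\sigma=w^{1-r'}$, $\tau_n=2^{n+1}$, and define $q_r$ by $$\frac1p-\frac1{q_r}=\frac{\alpha}{n}\,\frac{\tau_n[\sigma]_{A_\infty}}{1+r(\tau_n[\sigma]_{A_\infty}-1)};$$ if $r=1$, let $q_1=p^*_\alpha$. Then $$\|I_\alpha f\|_{L^{q_r,\infty}\left(B,\frac{w(x)dx}{w(B)}\right)}\le\frac{c_n}{\alpha}\,p^*_\alpha\,[w]_{A_r}^{\frac1p}\,r(B)^\alpha\left(\frac1{w(B)}\int_B|f(x)|^pw(x)\,dx\right)^{\frac1p}$$ for any ball $B\subset\mathbb{R}^n$ and every $f\in L^p(B,w)$ (extended by $0$ outside $B$).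
   Context: A weight is a non-negative locally integrable function on $\mathbb{R}^n$; $w(E)=\int_E w$; $r(B)$ is the radius of the ball $B$; $p'$ is the conjugate exponent, $\frac1p+\frac1{p'}=1$. $M$ is the Hardy–Littlewood maximal operator $Mf(x)=\sup_B\left(\frac1{|B|}\int_B|f|\right)\chi_B(x)$, supremum over all balls. $w\in A_p$ for $p>1$ means $[w]_{A_p}=\sup_B\left(\frac1{|B|}\int_Bw\right)\left(\frac1{|B|}\int_Bw^{1-p'}\right)^{p-1}<\infty$; $w\in A_1$ means $[w]_{A_1}=\|Mw/w\|_{L^\infty}<\infty$. $A_\infty=\bigcup_{p>1}A_p$, and $[w]_{A_\infty}=\sup_B\frac1{w(B)}\int_BM(w\chi_B)(x)\,dx$. Suprema are over all balls $B$. If $w\in A_r$ with $r>1$, then $\sigma=w^{1-r'}\in A_{r'}\subset A_\infty$. The Riesz potential of order $\alpha\in(0,n)$ is $I_\alpha f(x)=\int_{\mathbb{R}^n}\frac{f(y)}{|x-y|^{n-\alpha}}\,dy$. $L^p(B,w)$ is the space of $f$ on $B$ with $\int_B|f|^pw<\infty$. The weak average is $$\|g\|_{L^{q,\infty}\left(B,\frac{w(x)dx}{w(B)}\right)}=\sup_{t>0}t\left(\frac{w(\{x\in B:|g(x)|>t\})}{w(B)}\right)^{\frac1q}.$$ *)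

theory Defs
  imports "HOL-Analysis.Analysis" "HOL-Probability.Essential_Supremum"
begin

text \<open>
  Weights and all averages take values in \<open>ennreal\<close>, because \<open>0 powr a = 0\<close> on the reals would
  give negative powers of a weight the wrong value where the weight vanishes.  Balls are open.
\<close>

text \<open>Real powers on \<open>[0, \<infinity>]\<close>, with \<open>0\<close> to a negative power equal to \<open>\<infinity>\<close> and conversely.\<close>

definition epowr :: "ennreal \<Rightarrow> real \<Rightarrow> ennreal" where
  "epowr x a =
     (if a = 0 then 1
      else if a > 0 then (if x = top then top else ennreal (enn2real x powr a))
      else (if x = top then 0 else if x = 0 then top else ennreal (enn2real x powr a)))"

definition conj_exponent :: "real \<Rightarrow> real" where
  "conj_exponent p = p / (p - 1)"

definition weight :: "(real ^ 'n \<Rightarrow> ennreal) \<Rightarrow> bool" where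
  "weight w \<longleftrightarrow> w \<in> borel_measurable lebesgue \<and>
     (\<forall>x R. (\<integral>\<^sup>+ y \<in> ball x R. w y \<partial>lebesgue) < top)"

definition wmeasure :: "(real ^ 'n \<Rightarrow> ennreal) \<Rightarrow> (real ^ 'n) set \<Rightarrow> ennreal" where
  "wmeasure w E = (\<integral>\<^sup>+ x \<in> E. w x \<partial>lebesgue)"

definition average :: "(real ^ 'n) set \<Rightarrow> (real ^ 'n \<Rightarrow> ennreal) \<Rightarrow> ennreal" where
  "average B g = (\<integral>\<^sup>+ x \<in> B. g x \<partial>lebesgue) / emeasure lebesgue B"

definition balls :: "(real ^ 'n) set set" where
  "balls = {ball x R | x R. R > 0}"

text \<open>Uncentred Hardy--Littlewood maximal function; the argument \<open>g\<close> stands for \<open>\<bar>f\<bar>\<close>.\<close>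

definition maximal :: "(real ^ 'n \<Rightarrow> ennreal) \<Rightarrow> real ^ 'n \<Rightarrow> ennreal" where
  "maximal g x = (SUP B \<in> balls. average B g * indicator B x)"

text \<open>In the quotient for \<open>p = 1\<close>, division in \<open>ennreal\<close> gives \<open>a / 0 = \<infinity>\<close> for \<open>a > 0\<close>.\<close>

definition Ap_const :: "real \<Rightarrow> (real ^ 'n \<Rightarrow> ennreal) \<Rightarrow> ennreal" where
  "Ap_const p w =
     (if p = 1 then esssup lebesgue (\<lambda>x. maximal w x / w x)
      else (SUP B \<in> balls. average B w *
              epowr (average B (\<lambda>x. epowr (w x) (1 - conj_exponent p))) (p - 1)))"

definition Ap :: "real \<Rightarrow> (real ^ 'n \<Rightarrow> ennreal) set" where
  "Ap p = {w. weight w \<and> Ap_const p w < top}"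

definition Ainf_const :: "(real ^ 'n \<Rightarrow> ennreal) \<Rightarrow> ennreal" where
  "Ainf_const w =
     (SUP B \<in> balls. (\<integral>\<^sup>+ x \<in> B. maximal (\<lambda>y. w y * indicator B y) x \<partial>lebesgue) / wmeasure w B)"

definition dual_weight :: "real \<Rightarrow> (real ^ 'n \<Rightarrow> ennreal) \<Rightarrow> real ^ 'n \<Rightarrow> ennreal" where
  "dual_weight r w x = epowr (w x) (1 - conj_exponent r)"

text \<open>
  For \<open>f\<close> integrable with bounded support the integral converges absolutely for almost every \<open>x\<close>;
  at the remaining points the Bochner integral is \<open>0\<close> by convention.
\<close>

definition riesz_potential :: "real \<Rightarrow> (real ^ 'n \<Rightarrow> real) \<Rightarrow> real ^ 'n \<Rightarrow> real" where
  "riesz_potential \<alpha> f x =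
     (LINT y|lebesgue. f y / norm (x - y) powr (real CARD('n) - \<alpha>))"

definition zero_extension :: "(real ^ 'n) set \<Rightarrow> (real ^ 'n \<Rightarrow> real) \<Rightarrow> real ^ 'n \<Rightarrow> real" where
  "zero_extension B f x = (if x \<in> B then f x else 0)"

definition weighted_Lp ::
    "real \<Rightarrow> (real ^ 'n) set \<Rightarrow> (real ^ 'n \<Rightarrow> ennreal) \<Rightarrow> (real ^ 'n \<Rightarrow> real) set" where
  "weighted_Lp p B w =
     {f. zero_extension B f \<in> borel_measurable lebesgue \<and>
         (\<integral>\<^sup>+ x \<in> B. ennreal (\<bar>f x\<bar> powr p) * w x \<partial>lebesgue) < top}"

definition weak_average ::
    "real \<Rightarrow> (real ^ 'n) set \<Rightarrow> (real ^ 'n \<Rightarrow> ennreal) \<Rightarrow> (real ^ 'n \<Rightarrow> real) \<Rightarrow> ennreal" where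
  "weak_average q B w g =
     (SUP t \<in> {0<..}. ennreal t * epowr (wmeasure w {x \<in> B. \<bar>g x\<bar> > t} / wmeasure w B) (1 / q))"

definition sobolev_exponent :: "real \<Rightarrow> real \<Rightarrow> real \<Rightarrow> real" where
  "sobolev_exponent n \<alpha> p = n * p / (n - \<alpha> * p)"

end

theory Submission
  imports Defs
begin

text \<open>
  The \<open>A\<^sub>\<infinity>\<close> constant of the dual weight \<open>\<sigma>\<close> is needed only for concentric balls, and there it has an elementary
  consequence that replaces the sharp reverse Hoelder inequality.  On \<open>B\<^sub>j = B(x, 2\<^sup>-\<^sup>j r)\<close> the maximal
  function of \<open>\<sigma> \<chi>\<close> is at least \<open>\<sigma>(B\<^sub>m) / \<bar>B\<^sub>j\<bar>\<close> for \<open>j \<le> m\<close>; integrating, \<open>(1 + m / 2) \<sigma>(B\<^sub>m) \<le> [\<sigma>] \<sigma>(B\<^sub>0)\<close>.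
  With \<open>m\<close> just below \<open>4 [\<sigma>]\<close> the mass halves, and iteration gives
  \<open>\<sigma>(B(x, \<rho>)) \<le> 2 (\<rho> / R)\<^sup>n\<^sup>\<kappa> \<sigma>(B(x, R))\<close> with \<open>\<kappa> = 1 / (\<tau>\<^sub>n [\<sigma>])\<close>.

  Inserted into Hoelder's inequality, this bounds the integral of \<open>\<bar>f\<bar>\<close> over a ball of radius \<open>\<rho>\<close> by
  \<open>\<rho>\<^sup>n\<^sup>-\<^sup>a R\<^sup>a [w]\<^sup>1\<^sup>/\<^sup>p\<close> times the weighted average of \<open>f\<close>, where \<open>a = n s / p\<close> and \<open>s = r - \<kappa> (r - 1)\<close>.
  The kernel is then split at a radius \<open>\<rho>\<close> depending on the level \<open>t\<close> alone, chosen such that the far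
  part is at most \<open>t / 2\<close>.  At points of the level set some ball of radius at most \<open>\<rho>\<close> has a large
  average, and a Vitali covering argument bounds the weight of the level set.
\<close>

subsection \<open>A three-term Hoelder inequality\<close>

lemma emeasure_lebesgue_ball:
  fixes x :: "real ^ 'n"
  assumes "0 < r"
  shows "emeasure lebesgue (ball x r) = ennreal (unit_ball_vol (real CARD('n)) * r powr real CARD('n))"
  using emeasure_ball[of r x] assms by (simp add: powr_realpow)

text \<open>With \<open>t\<close> the product on the left, the tangent bound
  \<open>ln u - ln t \<le> u / t - 1\<close> is taken at the three points and averaged. The averaged
  logarithms cancel because the exponents sum to one.\<close>

lemma weighted_AM_GM_three:
  fixes x y z a b c :: real
  assumes pos: "0 < x" "0 < y" "0 < z" and nn: "0 \<le> a" "0 \<le> b" "0 \<le> c" and sum: "a + b + c = 1"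
  shows "x powr a * y powr b * z powr c \<le> a * x + b * y + c * z"
proof -
  define t where "t = x powr a * y powr b * z powr c"
  have t: "0 < t" using pos by (simp add: t_def)
  have ln_t: "ln t = a * ln x + b * ln y + c * ln z"
    using pos by (simp add: t_def ln_mult ln_powr)
  have ln_le: "ln u - ln t \<le> u / t - 1" if "0 < u" for u
    using ln_le_minus_one[of "u / t"] that t by (simp add: ln_div)
  have "a * (ln x - ln t) + b * (ln y - ln t) + c * (ln z - ln t)
        \<le> a * (x / t - 1) + b * (y / t - 1) + c * (z / t - 1)"
    by (intro add_mono mult_left_mono ln_le pos nn)
  moreover have "a * (ln x - ln t) + b * (ln y - ln t) + c * (ln z - ln t) = ln t - (a + b + c) * ln t"
    by (simp add: ln_t algebra_simps)
  moreover have "a * (x / t - 1) + b * (y / t - 1) + c * (z / t - 1)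
      = (a * x + b * y + c * z) / t - (a + b + c)"
    by (simp add: field_simps add_divide_distrib)
  ultimately have "1 \<le> (a * x + b * y + c * z) / t"
    by (simp add: sum)
  then show ?thesis
    using t by (simp add: t_def field_simps)
qed

text \<open>The weighted AM-GM inequality is applied to the normalised densities \<open>f\<^sup>p w / X\<close>,
  \<open>s / Y\<close>, \<open>1 / Z\<close> and integrated.\<close>

lemma weighted_Holder_three:
  fixes f w s :: "'a \<Rightarrow> real" and p r X Y Z :: real
  assumes meas [measurable]: "f \<in> borel_measurable M" "w \<in> borel_measurable M" "s \<in> borel_measurable M"
    and b [measurable]: "b \<in> sets M"
    and dual: "AE x in M. 0 < w x \<and> 0 < s x \<and> w x * s x powr (r - 1) = 1"
    and f: "\<And>x. 0 \<le> f x" and r: "1 \<le> r" "r \<le> p"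
    and pos: "0 < X" "0 < Y" "0 < Z"
    and X: "(\<integral>\<^sup>+x\<in>b. ennreal (f x powr p * w x) \<partial>M) \<le> ennreal X"
    and Y: "(\<integral>\<^sup>+x\<in>b. ennreal (s x) \<partial>M) \<le> ennreal Y"
    and Z: "emeasure M b \<le> ennreal Z"
  shows "(\<integral>\<^sup>+x\<in>b. ennreal (f x) \<partial>M)
      \<le> ennreal (X powr (1 / p) * Y powr ((r - 1) / p) * Z powr (1 - r / p))"
proof -
  define D where "D = X powr (1 / p) * Y powr ((r - 1) / p) * Z powr (1 - r / p)"
  have D: "0 < D" using pos by (simp add: D_def)
  have p: "1 \<le> p" "0 < p" using r by auto
  have exps: "0 \<le> 1 / p" "0 \<le> (r - 1) / p" "0 \<le> 1 - r / p" "1 / p + (r - 1) / p + (1 - r / p) = 1"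
    using r p by (auto simp: field_simps)
  have ptw: "f x \<le> D * (1 / p / X * (f x powr p * w x) + (r - 1) / p / Y * s x + (1 - r / p) / Z)"
    if "0 < w x \<and> 0 < s x \<and> w x * s x powr (r - 1) = 1" for x
  proof (cases "f x = 0")
    case True
    then show ?thesis
      using that exps pos D r p by (simp add: less_imp_le)
  next
    case False
    then have fx: "0 < f x" using f[of x] by simp
    \<comment> \<open>The duality \<open>w x * s x powr (r - 1) = 1\<close> makes the weights cancel
      at exactly these exponents; the remaining exponent \<open>1 - r / p\<close> goes to the
      constant density \<open>1 / Z\<close>.\<close>
    have "f x = (f x powr p * w x) powr (1 / p) * s x powr ((r - 1) / p)"
    proof -
      have "(f x powr p * w x) powr (1 / p) * s x powr ((r - 1) / p)
          = f x * (w x powr (1 / p) * (s x powr (r - 1)) powr (1 / p))"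
        using that fx p by (simp add: powr_mult powr_powr)
      also have "w x powr (1 / p) * (s x powr (r - 1)) powr (1 / p) = (w x * s x powr (r - 1)) powr (1 / p)"
        using that by (subst powr_mult) auto
      finally show ?thesis using that by simp
    qed
    also have "\<dots> = D * ((f x powr p * w x / X) powr (1 / p) * (s x / Y) powr ((r - 1) / p) * (1 / Z) powr (1 - r / p))"
      using that fx pos by (simp add: D_def powr_divide)
    also have "\<dots> \<le> D * (1 / p * (f x powr p * w x / X) + (r - 1) / p * (s x / Y) + (1 - r / p) * (1 / Z))"
      using that fx pos D by (intro mult_left_mono weighted_AM_GM_three exps) auto
    finally show ?thesis by (simp add: mult.commute)
  qed
  have lin: "ennreal D * (ennreal c1 * ennreal u1 + ennreal c2 * ennreal u2 + ennreal c3 * ennreal u3)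
      = ennreal (D * (c1 * u1 + c2 * u2 + c3 * u3))"
    if "0 \<le> c1" "0 \<le> c2" "0 \<le> c3" "0 \<le> u1" "0 \<le> u2" "0 \<le> u3" for c1 c2 c3 u1 u2 u3
    using that D by (simp add: ennreal_mult ennreal_plus)
  have nn: "0 \<le> 1 / p / X" "0 \<le> (r - 1) / p / Y" "0 \<le> (1 - r / p) / Z"
    using exps pos r p by simp_all
  have "(\<integral>\<^sup>+x\<in>b. ennreal (f x) \<partial>M)
     \<le> (\<integral>\<^sup>+x. ennreal D * (ennreal (1 / p / X) * (ennreal (f x powr p * w x) * indicator b x)
            + ennreal ((r - 1) / p / Y) * (ennreal (s x) * indicator b x)
            + ennreal ((1 - r / p) / Z) * indicator b x) \<partial>M)"
  proof (rule nn_integral_mono_AE)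
    show "AE x in M. ennreal (f x) * indicator b x \<le> ennreal D * (ennreal (1 / p / X) * (ennreal (f x powr p * w x) * indicator b x)
            + ennreal ((r - 1) / p / Y) * (ennreal (s x) * indicator b x)
            + ennreal ((1 - r / p) / Z) * indicator b x)"
      using dual
    proof eventually_elim
      case (elim x)
      show ?case
      proof (cases "x \<in> b")
        case True
        have "0 \<le> f x powr p * w x" "0 \<le> s x" using elim by auto
        from lin[OF nn this zero_le_one] show ?thesis
          using True ptw[OF elim] by (simp only: indicator_simps mult_1_right ennreal_1 ennreal_leI)
      qed simp
    qed
  qed
  also have "\<dots> = ennreal D * (ennreal (1 / p / X) * (\<integral>\<^sup>+x\<in>b. ennreal (f x powr p * w x) \<partial>M)
       + ennreal ((r - 1) / p / Y) * (\<integral>\<^sup>+x\<in>b. ennreal (s x) \<partial>M)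
       + ennreal ((1 - r / p) / Z) * emeasure M b)"
    by (simp add: nn_integral_cmult nn_integral_add)
  also have "\<dots> \<le> ennreal D * (ennreal (1 / p / X) * ennreal X
       + ennreal ((r - 1) / p / Y) * ennreal Y
       + ennreal ((1 - r / p) / Z) * ennreal Z)"
    by (intro mult_left_mono add_mono X Y Z) auto
  also have "\<dots> = ennreal (D * (1 / p + (r - 1) / p + (1 - r / p)))"
    using lin[OF nn, of X Y Z] pos by simp
  also have "\<dots> = ennreal D"
    by (simp only: exps(4) mult_1_right)
  finally show ?thesis by (simp add: D_def)
qed

subsection \<open>Decay on concentric balls\<close>

lemma average_le_maximal:
  assumes "0 < r" "y \<in> ball x r"
  shows "average (ball x r) g \<le> maximal g y"
proof -
  have "average (ball x r) g * indicator (ball x r) y \<le> maximal g y"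
    unfolding maximal_def by (rule SUP_upper) (use assms in \<open>auto simp: balls_def\<close>)
  then show ?thesis using assms by simp
qed

lemma wmeasure_mono: "E \<subseteq> F \<Longrightarrow> wmeasure w E \<le> wmeasure w F"
  unfolding wmeasure_def by (rule nn_integral_mono) (auto split: split_indicator)

text \<open>A step function \<open>h m\<close> is integrated that equals \<open>1 / v j\<close> on
  \<open>B j\<close> outside \<open>B (Suc j)\<close>, and \<open>1 / v m\<close> on the innermost
  ball, \<open>v j\<close> being the volume of \<open>B j\<close>. The maximal function dominates
  \<open>h m\<close> times the mass of \<open>B m\<close>, and the integral of \<open>h m\<close> is
  at least \<open>1 + m / 2\<close>.\<close>

lemma dyadic_maximal_integral:
  fixes w :: "real ^ 'n \<Rightarrow> ennreal" and r :: real
  assumes r: "0 < r"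
  shows "ennreal (1 + real m / 2) * wmeasure w (ball x (r / 2 ^ m))
     \<le> (\<integral>\<^sup>+y\<in>ball x r. maximal (\<lambda>z. w z * indicator (ball x r) z) y \<partial>lebesgue)"
proof -
  define B where "B j = ball x (r / 2 ^ j)" for j :: nat
  define v where "v j = unit_ball_vol (real CARD('n)) * (r / 2 ^ j) powr real CARD('n)" for j :: nat
  \<comment> \<open>The increments of \<open>1 / v\<close>: they write the step function as a
    nonnegative combination of indicators of nested balls, with telescoping partial sums.\<close>
  define c where "c j = (case j of 0 \<Rightarrow> 1 / v 0 | Suc i \<Rightarrow> 1 / v (Suc i) - 1 / v i)" for j
  define h where "h k y = (\<Sum>j\<le>k. c j * indicator (B j) y)" for k y
  have v: "0 < v j" for j using r by (simp add: v_def)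
  have v_Suc: "v (Suc j) = v j / 2 ^ CARD('n)" for j
    using r by (simp add: v_def powr_realpow power_divide power_mult_distrib)
  have emB: "emeasure lebesgue (B j) = ennreal (v j)" for j
    using r unfolding B_def v_def by (intro emeasure_lebesgue_ball) simp
  have [measurable]: "B j \<in> sets lebesgue" for j by (simp add: B_def)
  have pow2: "(2::real) \<le> 2 ^ CARD('n)"
    using power_increasing[of 1 "CARD('n)" "2::real"] by (simp add: Suc_le_eq)
  have c: "0 \<le> c j" for j
    using v[of "j - 1"] v[of 0] pow2 by (cases j) (auto simp: c_def v_Suc field_simps)
  \<comment> \<open>Halving the radius divides the volume by \<open>2 ^ n\<close>, so each further
    layer contributes \<open>1 - 1 / 2 ^ n\<close>, which is at least \<open>1 / 2\<close>.\<close>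
  have cv: "c 0 * v 0 = 1" "1 / 2 \<le> c (Suc j) * v (Suc j)" for j
    using v[of 0] v[of j] v[of "Suc j"] pow2 by (auto simp: c_def v_Suc field_simps)
  have B_mono: "B j \<subseteq> B i" if "i \<le> j" for i j
    using r that by (auto simp: B_def intro!: subset_ball divide_left_mono power_increasing)
  have sum_c: "(\<Sum>j\<le>k. c j) = 1 / v k" for k
    by (induction k) (auto simp: c_def)
  have h_eq: "\<exists>j\<le>k. y \<in> B j \<and> h k y = 1 / v j" if "y \<in> B 0" for k y
  proof (induction k)
    case 0
    then show ?case using that by (simp add: h_def c_def)
  next
    case (Suc k)
    show ?case
    proof (cases "y \<in> B (Suc k)")
      case True
      then have "y \<in> B j" if "j \<le> Suc k" for j using B_mono that by blast
      then have "h (Suc k) y = (\<Sum>j\<le>Suc k. c j)" 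
        unfolding h_def by (intro sum.cong) auto
      then show ?thesis unfolding sum_c using True by blast
    next
      case False
      then have "h (Suc k) y = h k y" by (simp add: h_def)
      then show ?thesis using Suc le_SucI by metis
    qed
  qed
  have h_nonneg: "0 \<le> h k y" for k y
    using c by (auto simp: h_def intro!: sum_nonneg)
  have "(1 + real m / 2) \<le> (\<Sum>j\<le>m. c j * v j)"
  proof (induction m)
    case (Suc m)
    then show ?case using cv(2)[of m] by (simp add: add_divide_distrib)
  qed (use cv in simp)
  then have "ennreal (1 + real m / 2) \<le> (\<Sum>j\<le>m. ennreal (c j) * emeasure lebesgue (B j))"
    using c v by (simp add: emB less_imp_le ennreal_leI flip: ennreal_mult ennreal_plus ennreal_1)
  also have "\<dots> = (\<integral>\<^sup>+y. ennreal (h m y) \<partial>lebesgue)"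
  proof -
    have "ennreal (h m y) = (\<Sum>j\<le>m. ennreal (c j) * indicator (B j) y)" for y
      unfolding h_def using c
      by (subst sum_ennreal[symmetric]) (auto intro!: sum.cong simp: indicator_def)
    then show ?thesis
      by (simp only:) (subst nn_integral_sum; simp add: nn_integral_cmult)
  qed
  finally have "ennreal (1 + real m / 2) * wmeasure w (B m)
      \<le> (\<integral>\<^sup>+y. ennreal (h m y) \<partial>lebesgue) * wmeasure w (B m)"
    by (rule mult_right_mono) simp
  also have "\<dots> = (\<integral>\<^sup>+y. ennreal (h m y) * wmeasure w (B m) \<partial>lebesgue)"
    by (rule nn_integral_multc[symmetric]) (unfold h_def, measurable)
  also have "\<dots> \<le> (\<integral>\<^sup>+y\<in>B 0. maximal (\<lambda>z. w z * indicator (B 0) z) y \<partial>lebesgue)"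
  proof (rule nn_integral_mono)
    fix y
    show "ennreal (h m y) * wmeasure w (B m)
        \<le> maximal (\<lambda>z. w z * indicator (B 0) z) y * indicator (B 0) y"
    proof (cases "y \<in> B 0")
      case True
      from h_eq[OF True] obtain j where j: "j \<le> m" "y \<in> B j" "h m y = 1 / v j" by blast
      have "wmeasure w (B m) \<le> wmeasure w (B j)" by (intro wmeasure_mono B_mono j)
      also have "\<dots> = (\<integral>\<^sup>+z\<in>B j. (w z * indicator (B 0) z) \<partial>lebesgue)"
        unfolding wmeasure_def using B_mono[of 0 j]
        by (intro nn_integral_cong) (auto split: split_indicator)
      finally have "ennreal (h m y) * wmeasure w (B m) \<le> average (B j) (\<lambda>z. w z * indicator (B 0) z)"
        unfolding average_def emB j divide_ennreal_def inverse_ennreal[OF v] inverse_eq_divide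
        by (subst mult.commute) (rule mult_right_mono, simp_all)
      also have "\<dots> \<le> maximal (\<lambda>z. w z * indicator (B 0) z) y"
        unfolding B_def using j(2) r by (intro average_le_maximal) (auto simp: B_def)
      finally show ?thesis using True by simp
    next
      case False
      then have "y \<notin> B j" for j using B_mono[of 0 j] by auto
      then show ?thesis by (simp add: h_def)
    qed
  qed
  finally show ?thesis by (simp add: B_def)
qed

text \<open>The halving is iterated as often as the radius permits, namely the integer part of the
  logarithm of \<open>R / \<rho>\<close> to base \<open>2 ^ m\<close>. The factor 2 pays for the
  rounding, and the exponent may drop from \<open>1 / m\<close> to \<open>\<kappa>\<close> since
  \<open>\<rho> / R \<le> 1\<close>.\<close>

lemma geometric_decay:
  fixes \<phi> :: "real \<Rightarrow> real" and m :: nat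
  assumes mono: "\<And>s t. 0 < s \<Longrightarrow> s \<le> t \<Longrightarrow> \<phi> s \<le> \<phi> t"
    and nonneg: "\<And>t. 0 < t \<Longrightarrow> 0 \<le> \<phi> t"
    and half: "\<And>t. 0 < t \<Longrightarrow> \<phi> (t / 2 ^ m) \<le> \<phi> t / 2"
    and m: "0 < m" "\<kappa> \<le> 1 / real m" and \<rho>: "0 < \<rho>" "\<rho> \<le> R"
  shows "\<phi> \<rho> \<le> 2 * (\<rho> / R) powr \<kappa> * \<phi> R"
proof -
  have R: "0 < R" using \<rho> by simp
  have iter: "\<phi> (R / 2 ^ (m * i)) \<le> \<phi> R / 2 ^ i" for i
  proof (induction i)
    case (Suc i)
    have "\<phi> (R / 2 ^ (m * Suc i)) = \<phi> (R / 2 ^ (m * i) / 2 ^ m)"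
      by (simp add: power_add mult.commute)
    also have "\<dots> \<le> \<phi> (R / 2 ^ (m * i)) / 2" using R by (intro half) simp
    finally show ?case using Suc by simp
  qed simp
  define l where "l = log 2 (R / \<rho>) / real m"
  have l: "0 \<le> l" using \<rho> by (simp add: l_def)
  define i where "i = nat \<lfloor>l\<rfloor>"
  have i: "real i \<le> l" "l < real i + 1" using l by (auto simp: i_def)
  have Rp: "R / \<rho> = 2 powr (real m * l)" using \<rho> R m by (simp add: l_def)
  have "2 ^ (m * i) = 2 powr (real m * real i)" by (simp flip: powr_realpow)
  also have "\<dots> \<le> R / \<rho>" unfolding Rp using i m by (intro powr_mono) auto
  finally have "\<rho> \<le> R / 2 ^ (m * i)" using \<rho> by (simp add: field_simps)
  then have "\<phi> \<rho> \<le> \<phi> R / 2 ^ i" using mono[OF \<rho>(1)] iter[of i] by fastforce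
  also have "\<dots> = 2 * 2 powr (- (real i + 1)) * \<phi> R"
  proof -
    have "2 powr (- (real i + 1)) = 1 / (2 * 2 ^ i)"
      using powr_realpow[of 2 "Suc i"] powr_minus_divide[of 2 "real i + 1"] by (simp add: add.commute)
    then show ?thesis by (simp only:) simp
  qed
  also have "\<dots> \<le> 2 * (\<rho> / R) powr (1 / real m) * \<phi> R"
  proof -
    have "\<rho> / R = 2 powr (- (real m * l))"
      unfolding powr_minus Rp[symmetric] by simp
    then have "(\<rho> / R) powr (1 / real m) = 2 powr (- l)"
      using m by (simp add: powr_powr)
    moreover have "(2::real) powr (- (real i + 1)) \<le> 2 powr (- l)"
      using i by (intro powr_mono) auto
    ultimately show ?thesis using nonneg[OF R] by (intro mult_right_mono) auto
  qed
  also have "\<dots> \<le> 2 * (\<rho> / R) powr \<kappa> * \<phi> R"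
    using m \<rho> R nonneg[OF R] by (intro mult_right_mono mult_left_mono powr_mono') auto
  finally show ?thesis .
qed

lemma Ainf_ball_decay:
  fixes w :: "real ^ 'n \<Rightarrow> ennreal"
  assumes pos: "\<And>x r. 0 < r \<Longrightarrow> 0 < wmeasure w (ball x r)"
    and fin: "\<And>x r. wmeasure w (ball x r) < top"
    and Ainf: "Ainf_const w < top"
  defines "A \<equiv> enn2real (Ainf_const w)"
  shows "1 \<le> A"
    and "0 < \<rho> \<Longrightarrow> \<rho> \<le> R \<Longrightarrow> enn2real (wmeasure w (ball x \<rho>))
       \<le> 2 * (\<rho> / R) powr (real CARD('n) / (2 ^ (CARD('n) + 1) * A)) * enn2real (wmeasure w (ball x R))"
proof -
  define \<phi> where "\<phi> x r = enn2real (wmeasure w (ball x r))" for x r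
  have \<phi>: "wmeasure w (ball x r) = ennreal (\<phi> x r)" for x r
    using fin by (simp add: \<phi>_def)
  have \<phi>_pos: "0 < \<phi> x r" if "0 < r" for x r
    using pos[OF that, of x] fin[of x r] by (simp add: \<phi>_def enn2real_positive_iff)
  have A: "Ainf_const w = ennreal A" "0 \<le> A" using Ainf by (simp_all add: A_def)
  have key: "(1 + real m / 2) * \<phi> x (r / 2 ^ m) \<le> A * \<phi> x r" if r: "0 < r" for x r m
  proof -
    let ?I = "\<integral>\<^sup>+y\<in>ball x r. maximal (\<lambda>z. w z * indicator (ball x r) z) y \<partial>lebesgue"
    have "?I / ennreal (\<phi> x r) \<le> ennreal A"
      unfolding A(1)[symmetric] Ainf_const_def \<phi>[symmetric]
      by (rule SUP_upper2[of "ball x r"]) (use r in \<open>auto simp: balls_def\<close>)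
    then have "?I / ennreal (\<phi> x r) * ennreal (\<phi> x r) \<le> ennreal A * ennreal (\<phi> x r)"
      by (rule mult_right_mono) simp
    then have "?I \<le> ennreal (A * \<phi> x r)"
      using \<phi>_pos[OF r, of x] A
      by (simp add: ennreal_divide_times ennreal_mult'' mult_divide_eq_ennreal)
    with dyadic_maximal_integral[OF r, of m w x]
    have "ennreal (1 + real m / 2) * wmeasure w (ball x (r / 2 ^ m)) \<le> ennreal (A * \<phi> x r)"
      by (rule order_trans)
    then have "ennreal ((1 + real m / 2) * \<phi> x (r / 2 ^ m)) \<le> ennreal (A * \<phi> x r)"
      using \<phi>_pos[of "r / 2 ^ m" x] r
      by (simp add: \<phi> ennreal_mult'')
    then show ?thesis
      using A \<phi>_pos[OF r, of x] by (subst (asm) ennreal_le_iff) auto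
  qed
  \<comment> \<open>The case \<open>m = 0\<close> on the unit ball, whose positive mass
    cancels.\<close>
  show A1: "1 \<le> A"
    using key[of 1 0 0] \<phi>_pos[of 1 0] by simp
  assume \<rho>: "0 < \<rho>" "\<rho> \<le> R"
  \<comment> \<open>The largest integer strictly below \<open>4 * A\<close>. The bound
    \<open>4 * A - 1 \<le> m\<close> gives \<open>2 * A \<le> 1 + m / 2\<close> and hence the
    halving, while \<open>m < 4 * A\<close> keeps \<open>1 / m\<close> above the claimed
    exponent.\<close>
  define m where "m = nat \<lceil>4 * A\<rceil> - 1"
  have m: "4 * A - 1 \<le> real m" "real m < 4 * A" 
    using A1 by (auto simp: m_def of_nat_diff) linarith+
  have m0: "0 < m" using m A1 by (cases m) auto
  have half: "\<phi> x (t / 2 ^ m) \<le> \<phi> x t / 2" if "0 < t" for t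
  proof -
    have "2 * A * \<phi> x (t / 2 ^ m) \<le> (1 + real m / 2) * \<phi> x (t / 2 ^ m)"
      using m \<phi>_pos[of "t / 2 ^ m" x] that by (intro mult_right_mono) auto
    also have "\<dots> \<le> A * \<phi> x t" by (rule key[OF that])
    finally show ?thesis using A1 by (simp add: mult.assoc)
  qed
  \<comment> \<open>The factor \<open>2 ^ (n + 1)\<close> is at least \<open>4 * n\<close>, so it
    absorbs both the dimension and the 4 in the choice of \<open>m\<close>.\<close>
  have "real CARD('n) / (2 ^ (CARD('n) + 1) * A) \<le> 1 / real m"
  proof -
    have "real k \<le> 2 ^ k / 2" if "0 < k" for k :: nat
      using that
    proof (induction k rule: nat_induct_non_zero)
      case (Suc k)
      then show ?case using one_le_power[of "2::real" k]
        by (auto simp: field_simps)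
    qed simp
    from this[of "CARD('n)"] have "4 * real CARD('n) \<le> 2 ^ (CARD('n) + 1)" by simp
    then have "real CARD('n) / (2 ^ (CARD('n) + 1) * A) \<le> 1 / (4 * A)"
      using A1 by (simp add: field_simps)
    also have "\<dots> \<le> 1 / real m" using m m0 by (intro divide_left_mono) auto
    finally show ?thesis .
  qed
  moreover have "\<phi> x s \<le> \<phi> x t" if "0 < s" "s \<le> t" for s t
    unfolding \<phi>_def using fin that by (intro enn2real_mono wmeasure_mono subset_ball) auto
  ultimately show "enn2real (wmeasure w (ball x \<rho>))
       \<le> 2 * (\<rho> / R) powr (real CARD('n) / (2 ^ (CARD('n) + 1) * A)) * enn2real (wmeasure w (ball x R))"
    unfolding \<phi>_def[symmetric]
    by (intro geometric_decay[of "\<phi> x", OF _ _ half m0 _ \<rho>] less_imp_le[OF \<phi>_pos])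
qed

subsection \<open>Dyadic splitting of the Riesz kernel and the covering argument\<close>

text \<open>The explicit \<open>1 / \<beta>\<close> later becomes \<open>1 / \<alpha>\<close> in the
  near part and \<open>1 / (a - \<alpha>)\<close> in the far part. It comes from
  \<open>2 powr \<beta> \<ge> 1 + \<beta> / 2\<close>, a consequence of
  \<open>ln 2 \<ge> 1 / 2\<close>.\<close>

lemma suminf_dyadic_le:
  assumes \<beta>: "0 < \<beta>" "\<beta> \<le> N"
  shows "(\<Sum>k. ennreal ((2 powr - \<beta>) ^ k)) \<le> ennreal (2 * (1 + N) / \<beta>)"
proof -
  define q :: real where "q = 2 powr - \<beta>"
  have "1 / 2 \<le> ln (2 :: real)"
    using ln_add_one_self_le_self2[of "- 1 / 2"] by (simp add: ln_div)
  then have "1 + \<beta> / 2 \<le> 1 + \<beta> * ln 2" using \<beta> by simp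
  also have "\<dots> \<le> exp (\<beta> * ln 2)" by (rule exp_ge_add_one_self)
  also have "\<dots> = 1 / q" by (simp add: q_def powr_def exp_minus field_simps)
  finally have "q * (1 + \<beta> / 2) \<le> 1" 
    by (simp add: q_def field_simps)
  then have q: "\<beta> \<le> (1 - q) * (2 + \<beta>)" by (simp add: algebra_simps)
  have q01: "0 < q" "q < 1" using \<beta> by (auto simp: q_def powr_less_one)
  have "1 / (1 - q) \<le> (2 + \<beta>) / \<beta>"
    using q q01 \<beta> by (simp add: field_simps)
  also have "\<dots> \<le> 2 * (1 + N) / \<beta>" using \<beta> by (intro divide_right_mono) auto
  finally have "ennreal (1 / (1 - q)) \<le> ennreal (2 * (1 + N) / \<beta>)" by (rule ennreal_leI)
  moreover have "(\<Sum>k. ennreal (q ^ k)) = ennreal (1 / (1 - q))"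
    using q01 by (intro suminf_ennreal_eq geometric_sums) auto
  ultimately show ?thesis by (simp only: q_def)
qed

text \<open>Locates the dyadic shell of a point: \<open>P k\<close> will compare its distance from
  the centre with the \<open>k\<close>-th radius.\<close>

lemma ex_dyadic_step:
  fixes P :: "nat \<Rightarrow> bool"
  assumes "P 0" "\<not> P N"
  shows "\<exists>k. P k \<and> \<not> P (Suc k)"
  using assms by (induction N) auto

text \<open>Common core of the near and far estimates. On the shell between \<open>s k / 2\<close>
  and \<open>s k\<close> the kernel is at most \<open>2 ^ n * s k powr (\<alpha> - n)\<close>; the
  shell is then enlarged to the full ball, where the mass bound with growth exponent
  \<open>\<gamma>\<close> applies.\<close>

lemma dyadic_kernel_bound:
  fixes u :: "real ^ 'n \<Rightarrow> ennreal"
  assumes u [measurable]: "u \<in> borel_measurable lebesgue" and S [measurable]: "S \<in> sets lebesgue"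
    and \<alpha>: "0 < \<alpha>" "\<alpha> < real CARD('n)" and s: "\<And>k. 0 < s k" and D: "0 \<le> D"
    and cover: "\<And>y. y \<in> S \<Longrightarrow> y \<noteq> x \<Longrightarrow> \<exists>k. s k / 2 \<le> norm (x - y) \<and> norm (x - y) < s k"
    and mass: "\<And>k. (\<integral>\<^sup>+y\<in>ball x (s k). u y \<partial>lebesgue) \<le> ennreal (D * s k powr \<gamma>)"
  shows "(\<integral>\<^sup>+y\<in>S. (u y * ennreal (1 / norm (x - y) powr (real CARD('n) - \<alpha>))) \<partial>lebesgue)
     \<le> ennreal (2 ^ CARD('n) * D) * (\<Sum>k. ennreal (s k powr (\<alpha> - real CARD('n) + \<gamma>)))"
proof -
  let ?n = "real CARD('n)"
  define c where "c k = 2 ^ CARD('n) * s k powr (\<alpha> - ?n)" for k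
  have c: "0 \<le> c k" for k by (simp add: c_def)
  have [measurable]: "ball x t \<in> sets lebesgue" for t by simp
  have ptw: "u y * ennreal (1 / norm (x - y) powr (?n - \<alpha>)) * indicator S y
      \<le> (\<Sum>k. ennreal (c k) * (u y * indicator (ball x (s k)) y))" for y
  proof (cases "y \<in> S \<and> y \<noteq> x")
    case True
    with cover obtain k where k: "s k / 2 \<le> norm (x - y)" "norm (x - y) < s k" by blast
    have "1 / norm (x - y) powr (?n - \<alpha>) \<le> 1 / (s k / 2) powr (?n - \<alpha>)"
      using k(1) s[of k] \<alpha> True by (intro divide_left_mono powr_mono2) auto
    also have "\<dots> = 2 powr (?n - \<alpha>) * s k powr (\<alpha> - ?n)"
      using s[of k] powr_minus_divide[of "s k" "?n - \<alpha>"] by (simp add: powr_divide)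
    also have "\<dots> \<le> c k"
    proof -
      have "(2::real) powr (?n - \<alpha>) \<le> 2 powr ?n" using \<alpha> by (intro powr_mono) auto
      also have "\<dots> = 2 ^ CARD('n)" by (simp add: powr_realpow)
      finally show ?thesis unfolding c_def by (intro mult_right_mono) auto
    qed
    finally have "u y * ennreal (1 / norm (x - y) powr (?n - \<alpha>)) * indicator S y \<le> u y * ennreal (c k)"
      using True by (auto intro!: mult_left_mono ennreal_leI)
    also have "\<dots> = ennreal (c k) * (u y * indicator (ball x (s k)) y)"
      using k by (simp add: dist_norm mult.commute)
    also have "\<dots> \<le> (\<Sum>k. ennreal (c k) * (u y * indicator (ball x (s k)) y))"
      using sum_le_suminf[of "\<lambda>k. ennreal (c k) * (u y * indicator (ball x (s k)) y)" "{k}"] by simp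
    finally show ?thesis .
  \<comment> \<open>At \<open>y = x\<close> the kernel is \<open>1 / 0 = 0\<close>, because
    \<open>0 powr\<close> any exponent is 0; the centre contributes nothing.\<close>
  qed (use \<alpha> in auto)
  have "(\<integral>\<^sup>+y\<in>S. (u y * ennreal (1 / norm (x - y) powr (?n - \<alpha>))) \<partial>lebesgue)
     \<le> (\<integral>\<^sup>+y. (\<Sum>k. ennreal (c k) * (u y * indicator (ball x (s k)) y)) \<partial>lebesgue)"
    by (rule nn_integral_mono) (rule ptw)
  also have "\<dots> = (\<Sum>k. ennreal (c k) * (\<integral>\<^sup>+y\<in>ball x (s k). u y \<partial>lebesgue))"
    by (subst nn_integral_suminf) (measurable, simp add: nn_integral_cmult)
  also have "\<dots> \<le> (\<Sum>k. ennreal (c k) * ennreal (D * s k powr \<gamma>))"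
    by (intro suminf_le mult_left_mono mass) auto
  also have "\<dots> = (\<Sum>k. ennreal (2 ^ CARD('n) * D) * ennreal (s k powr (\<alpha> - ?n + \<gamma>)))"
    using D by (intro suminf_cong) (simp add: c_def ac_simps powr_add flip: ennreal_mult)
  also have "\<dots> = ennreal (2 ^ CARD('n) * D) * (\<Sum>k. ennreal (s k powr (\<alpha> - ?n + \<gamma>)))"
    by simp
  finally show ?thesis .
qed

text \<open>With mass of order \<open>t powr n\<close>, the shell of radius
  \<open>\<rho> / 2 ^ k\<close> contributes its radius to the power \<alpha>, up to a factor; these
  terms form a geometric series of ratio \<open>2 powr - \<alpha>\<close>.\<close>

lemma riesz_kernel_near:
  fixes u :: "real ^ 'n \<Rightarrow> ennreal"
  assumes u: "u \<in> borel_measurable lebesgue"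
    and \<alpha>: "0 < \<alpha>" "\<alpha> < real CARD('n)" and \<rho>: "0 < \<rho>" and l: "0 \<le> l"
    and mass: "\<And>t. 0 < t \<Longrightarrow> t \<le> \<rho> \<Longrightarrow> (\<integral>\<^sup>+y\<in>ball x t. u y \<partial>lebesgue) \<le> ennreal (l * t powr real CARD('n))"
  shows "(\<integral>\<^sup>+y\<in>ball x \<rho>. (u y * ennreal (1 / norm (x - y) powr (real CARD('n) - \<alpha>))) \<partial>lebesgue)
     \<le> ennreal (2 ^ CARD('n) * l * (\<rho> powr \<alpha> * (2 * (1 + real CARD('n)) / \<alpha>)))"
proof -
  define s where "s k = \<rho> / 2 ^ k" for k :: nat
  have s: "0 < s k" "s k \<le> \<rho>" for k
    using \<rho> by (auto simp: s_def field_simps)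
  have cover: "\<exists>k. s k / 2 \<le> norm (x - y) \<and> norm (x - y) < s k"
    if "y \<in> ball x \<rho>" "y \<noteq> x" for y
  proof -
    have pos: "0 < norm (x - y)" using that by simp
    obtain N where "\<rho> / norm (x - y) < 2 ^ N"
      using real_arch_pow[of 2 "\<rho> / norm (x - y)"] by auto
    then have N: "\<not> norm (x - y) < s N"
      using pos by (simp add: s_def field_simps)
    have "norm (x - y) < s 0" using that by (simp add: s_def dist_norm)
    from ex_dyadic_step[of "\<lambda>k. norm (x - y) < s k", OF this N] show ?thesis
      by (auto simp: s_def not_less mult.commute)
  qed
  have pw: "s k powr (\<alpha> - real CARD('n) + real CARD('n)) = \<rho> powr \<alpha> * (2 powr - \<alpha>) ^ k" for k
  proof -
    have "s k = \<rho> * 2 powr (- real k)"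
      by (simp add: s_def powr_minus powr_realpow divide_inverse)
    then show ?thesis using \<rho>
      by (simp add: powr_mult powr_powr powr_power mult.commute)
  qed
  have "(\<integral>\<^sup>+y\<in>ball x \<rho>. (u y * ennreal (1 / norm (x - y) powr (real CARD('n) - \<alpha>))) \<partial>lebesgue)
     \<le> ennreal (2 ^ CARD('n) * l) * (\<Sum>k. ennreal (s k powr (\<alpha> - real CARD('n) + real CARD('n))))"
    using s by (intro dyadic_kernel_bound u \<alpha> l cover mass) auto
  also have "\<dots> = ennreal (2 ^ CARD('n) * l) * (ennreal (\<rho> powr \<alpha>) * (\<Sum>k. ennreal ((2 powr - \<alpha>) ^ k)))"
    unfolding pw by (simp add: ennreal_mult)
  also have "\<dots> \<le> ennreal (2 ^ CARD('n) * l) * (ennreal (\<rho> powr \<alpha>) * ennreal (2 * (1 + real CARD('n)) / \<alpha>))"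
    using \<alpha> by (intro mult_left_mono suminf_dyadic_le) auto
  also have "\<dots> = ennreal (2 ^ CARD('n) * l * (\<rho> powr \<alpha> * (2 * (1 + real CARD('n)) / \<alpha>)))"
  proof -
    have nn: "0 \<le> 2 ^ CARD('n) * l" "0 \<le> \<rho> powr \<alpha>" "0 \<le> 2 * (1 + real CARD('n)) / \<alpha>"
      using \<alpha> l by simp_all
    show ?thesis
      by (simp only: ennreal_mult[OF nn(1) mult_nonneg_nonneg[OF nn(2,3)]] ennreal_mult[OF nn(2,3)])
  qed
  finally show ?thesis .
qed

text \<open>Here the radii double. The series converges because \<open>\<alpha> < a\<close> makes
  the mass grow more slowly than the kernel decays; its ratio is
  \<open>2 powr - (a - \<alpha>)\<close>.\<close>

lemma riesz_kernel_far:
  fixes u :: "real ^ 'n \<Rightarrow> ennreal"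
  assumes u: "u \<in> borel_measurable lebesgue"
    and \<alpha>: "0 < \<alpha>" "\<alpha> < real CARD('n)" and a: "\<alpha> < a" "a \<le> real CARD('n)"
    and \<rho>: "0 < \<rho>" and D: "0 \<le> D"
    and mass: "\<And>t. 0 < t \<Longrightarrow> (\<integral>\<^sup>+y\<in>ball x t. u y \<partial>lebesgue) \<le> ennreal (D * t powr (real CARD('n) - a))"
  shows "(\<integral>\<^sup>+y\<in>- ball x \<rho>. (u y * ennreal (1 / norm (x - y) powr (real CARD('n) - \<alpha>))) \<partial>lebesgue)
     \<le> ennreal (2 ^ CARD('n) * D * (\<rho> powr (\<alpha> - a) * (2 * (1 + real CARD('n)) / (a - \<alpha>))))"
proof -
  \<comment> \<open>The initial factor 2 puts the inner edge \<open>s 0 / 2\<close> of the first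
    shell exactly at \<open>\<rho>\<close>.\<close>
  define s where "s k = 2 * \<rho> * 2 ^ k" for k :: nat
  have s: "0 < s k" for k
    using \<rho> by (auto simp: s_def)
  have cover: "\<exists>k. s k / 2 \<le> norm (x - y) \<and> norm (x - y) < s k"
    if "y \<in> - ball x \<rho>" "y \<noteq> x" for y
  proof -
    obtain N where "norm (x - y) / \<rho> < 2 ^ N"
      using real_arch_pow[of 2 "norm (x - y) / \<rho>"] by auto
    then have N: "\<not> s N / 2 \<le> norm (x - y)"
      using \<rho> by (simp add: s_def field_simps)
    have "s 0 / 2 \<le> norm (x - y)" using that by (simp add: s_def dist_norm)
    from ex_dyadic_step[of "\<lambda>k. s k / 2 \<le> norm (x - y)", OF this N] show ?thesis
      by (auto simp: s_def not_le mult.commute)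
  qed
  have pw: "s k powr (\<alpha> - real CARD('n) + (real CARD('n) - a)) = (2 * \<rho>) powr (\<alpha> - a) * (2 powr - (a - \<alpha>)) ^ k" for k
  proof -
    have "s k = (2 * \<rho>) * 2 powr (real k)"
      by (simp add: s_def powr_realpow)
    then show ?thesis using \<rho>
      by (simp add: powr_mult powr_powr powr_power algebra_simps)
  qed
  have "(\<integral>\<^sup>+y\<in>- ball x \<rho>. (u y * ennreal (1 / norm (x - y) powr (real CARD('n) - \<alpha>))) \<partial>lebesgue)
     \<le> ennreal (2 ^ CARD('n) * D) * (\<Sum>k. ennreal (s k powr (\<alpha> - real CARD('n) + (real CARD('n) - a))))"
    using s by (intro dyadic_kernel_bound u \<alpha> D cover mass) auto
  also have "\<dots> = ennreal (2 ^ CARD('n) * D) * (ennreal ((2 * \<rho>) powr (\<alpha> - a)) * (\<Sum>k. ennreal ((2 powr - (a - \<alpha>)) ^ k)))"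
    unfolding pw by (simp add: ennreal_mult)
  also have "\<dots> \<le> ennreal (2 ^ CARD('n) * D) * (ennreal (\<rho> powr (\<alpha> - a)) * ennreal (2 * (1 + real CARD('n)) / (a - \<alpha>)))"
  proof (intro mult_left_mono mult_mono)
    show "ennreal ((2 * \<rho>) powr (\<alpha> - a)) \<le> ennreal (\<rho> powr (\<alpha> - a))"
      using a \<rho> by (intro ennreal_leI powr_mono2') auto
    show "(\<Sum>k. ennreal ((2 powr - (a - \<alpha>)) ^ k)) \<le> ennreal (2 * (1 + real CARD('n)) / (a - \<alpha>))"
      using \<alpha> a by (intro suminf_dyadic_le) auto
  qed auto
  also have "\<dots> = ennreal (2 ^ CARD('n) * D * (\<rho> powr (\<alpha> - a) * (2 * (1 + real CARD('n)) / (a - \<alpha>))))"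
  proof -
    have nn: "0 \<le> 2 ^ CARD('n) * D" "0 \<le> \<rho> powr (\<alpha> - a)" "0 \<le> 2 * (1 + real CARD('n)) / (a - \<alpha>)"
      using \<alpha> a D by simp_all
    show ?thesis
      by (simp only: ennreal_mult[OF nn(1) mult_nonneg_nonneg[OF nn(2,3)]] ennreal_mult[OF nn(2,3)])
  qed
  finally show ?thesis .
qed

section \<open>Vitali covering for weighted masses\<close>

text \<open>Disjoint balls are selected whose dilates still cover \<open>E\<close>. The hypothesis
  is summed over them, and disjointness bounds the sum of the integrals of \<open>g\<close> by the
  total integral. \<open>E\<close> enters only through monotonicity of \<open>nn_integral\<close>,
  so it may be any set; the common bound \<open>\<rho>\<close> on the radii is what Vitali selection
  asks for.\<close>

lemma Vitali_weak_type:
  fixes w g :: "real ^ 'n \<Rightarrow> ennreal"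
  assumes [measurable]: "w \<in> borel_measurable lebesgue" "g \<in> borel_measurable lebesgue"
    and ball: "\<And>x. x \<in> E \<Longrightarrow> \<exists>s. 0 < s \<and> s \<le> \<rho> \<and>
        wmeasure w (ball x (6 * s)) \<le> Q * (\<integral>\<^sup>+y\<in>ball x s. g y \<partial>lebesgue)"
  shows "wmeasure w E \<le> Q * (\<integral>\<^sup>+y. g y \<partial>lebesgue)"
proof -
  obtain s where s: "\<And>x. x \<in> E \<Longrightarrow> 0 < s x \<and> s x \<le> \<rho> \<and>
      wmeasure w (ball x (6 * s x)) \<le> Q * (\<integral>\<^sup>+y\<in>ball x (s x). g y \<partial>lebesgue)"
    using ball by metis
  have sub: "E \<subseteq> (\<Union>x\<in>E. cball x (s x))" using s by (auto simp: less_imp_le)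
  have rad: "\<And>x. x \<in> E \<Longrightarrow> 0 < s x \<and> s x \<le> \<rho>" using s by blast
  obtain C where C: "countable C" "C \<subseteq> E"
    and disj: "pairwise (\<lambda>i j. disjnt (cball i (s i)) (cball j (s j))) C"
    and cov: "E \<subseteq> (\<Union>i\<in>C. cball i (5 * s i))"
    using Vitali_covering_lemma_cballs[OF sub rad] by blast
  \<comment> \<open>The covering lemma yields closed balls of radius \<open>5 * s i\<close>; the
    open balls of radius \<open>6 * s i\<close> contain them.\<close>
  have cov': "\<exists>i\<in>C. y \<in> ball i (6 * s i)" if "y \<in> E" for y
  proof -
    obtain i where i: "i \<in> C" "y \<in> cball i (5 * s i)" using cov \<open>y \<in> E\<close> by blast
    then have "0 < s i" using rad C by blast
    then have "y \<in> ball i (6 * s i)" using i by simp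
    then show ?thesis using i by blast
  qed
  have [measurable]: "ball i r \<in> sets lebesgue" for i :: "real ^ 'n" and r by simp
  \<comment> \<open>The sum over the countable set \<open>C\<close> is an integral against counting
    measure, so it can be exchanged with the Lebesgue integral.\<close>
  have "wmeasure w E \<le> (\<integral>\<^sup>+y. (\<integral>\<^sup>+i. w y * indicator (ball i (6 * s i)) y \<partial>count_space C) \<partial>lebesgue)"
    unfolding wmeasure_def
  proof (rule nn_integral_mono)
    fix y
    show "w y * indicator E y \<le> (\<integral>\<^sup>+i. w y * indicator (ball i (6 * s i)) y \<partial>count_space C)"
    proof (cases "y \<in> E")
      case True
      then obtain i where i: "i \<in> C" "y \<in> ball i (6 * s i)" using cov' by blast
      then have "w y * indicator E y = w y * indicator (ball i (6 * s i)) y" using True by simp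
      also have "\<dots> \<le> (\<integral>\<^sup>+i. w y * indicator (ball i (6 * s i)) y \<partial>count_space C)"
        using nn_integral_ge_point[OF i(1), of "\<lambda>i. w y * indicator (ball i (6 * s i)) y"] .
      finally show ?thesis .
    qed simp
  qed
  also have "\<dots> = (\<integral>\<^sup>+i. wmeasure w (ball i (6 * s i)) \<partial>count_space C)"
    unfolding wmeasure_def by (rule nn_integral_count_space_nn_integral) (use C in measurable)
  also have "\<dots> \<le> (\<integral>\<^sup>+i. Q * emeasure (density lebesgue g) (ball i (s i)) \<partial>count_space C)"
  proof (rule nn_integral_mono)
    fix i assume "i \<in> space (count_space C)"
    then have "i \<in> E" using C by auto
    from s[OF this] show "wmeasure w (ball i (6 * s i)) \<le> Q * emeasure (density lebesgue g) (ball i (s i))"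
      by (simp add: emeasure_density)
  qed
  also have "\<dots> = Q * (\<integral>\<^sup>+i. emeasure (density lebesgue g) (ball i (s i)) \<partial>count_space C)"
    by (rule nn_integral_cmult) simp
  also have "\<dots> = Q * emeasure (density lebesgue g) (\<Union>i\<in>C. ball i (s i))"
  proof -
    have "disjoint_family_on (\<lambda>i. ball i (s i)) C"
      unfolding disjoint_family_on_def
    proof (intro ballI impI)
      fix i j assume "i \<in> C" "j \<in> C" "i \<noteq> j"
      then have "disjnt (cball i (s i)) (cball j (s j))" using disj by (auto simp: pairwise_def)
      then show "ball i (s i) \<inter> ball j (s j) = {}" 
        using ball_subset_cball[of i "s i"] ball_subset_cball[of j "s j"] unfolding disjnt_def by blast
    qed
    then show ?thesis using C by (subst emeasure_UN_countable) auto
  qed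
  also have "\<dots> \<le> Q * emeasure (density lebesgue g) (space lebesgue)"
    by (intro mult_left_mono emeasure_mono) simp_all
  also have "emeasure (density lebesgue g) (space lebesgue) = (\<integral>\<^sup>+y. g y \<partial>lebesgue)"
    by (subst emeasure_density) simp_all
  finally show ?thesis .
qed

subsection \<open>Degenerate and non-degenerate weights\<close>

lemma sets_lebesgue_ball [measurable]: "ball x r \<in> sets lebesgue"
  by simp

lemma epowr_ennreal: "0 < a \<Longrightarrow> 0 \<le> x \<Longrightarrow> epowr (ennreal x) a = ennreal (x powr a)"
  by (simp add: epowr_def)

lemma epowr_top: "0 < a \<Longrightarrow> epowr top a = top"
  by (simp add: epowr_def)

lemma epowr_neg_pos_finite:
  assumes "a < 0" "0 < x" "x < top"
  shows "epowr x a = ennreal (enn2real x powr a)"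
  using assms by (auto simp: epowr_def)

lemma borel_measurable_epowr [measurable]:
  assumes [measurable]: "w \<in> borel_measurable M"
  shows "(\<lambda>x. epowr (w x) a) \<in> borel_measurable M"
  unfolding epowr_def by measurable

lemma AE_from_balls:
  fixes P :: "real ^ 'n \<Rightarrow> bool"
  assumes "\<And>R. 0 < R \<Longrightarrow> AE x in lebesgue. x \<in> ball 0 R \<longrightarrow> P x"
  shows "AE x in lebesgue. P x"
proof -
  have "AE x in lebesgue. \<forall>k::nat. x \<in> ball 0 (real (Suc k)) \<longrightarrow> P x"
    by (subst AE_all_countable) (use assms in \<open>auto simp del: of_nat_Suc\<close>)
  then show ?thesis
  proof eventually_elim
    case (elim x)
    obtain k :: nat where "norm x < real k" using reals_Archimedean2 by blast
    then have "x \<in> ball 0 (real (Suc k))" by simp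
    then show ?case using elim by blast
  qed
qed

lemma weight_AE_finite:
  fixes w :: "real ^ 'n \<Rightarrow> ennreal"
  assumes [measurable]: "w \<in> borel_measurable lebesgue" and "\<And>R. 0 < R \<Longrightarrow> wmeasure w (ball 0 R) < top"
  shows "AE x in lebesgue. w x < top"
proof (rule AE_from_balls)
  fix R :: real assume "0 < R"
  then have "(\<integral>\<^sup>+x. w x * indicator (ball 0 R) x \<partial>lebesgue) \<noteq> top"
    using assms(2)[of R] by (simp add: wmeasure_def less_top)
  then have "AE x in lebesgue. w x * indicator (ball 0 R) x \<noteq> \<infinity>"
    by (intro nn_integral_PInf_AE) (use assms(1) in simp_all)
  then show "AE x in lebesgue. x \<in> ball 0 R \<longrightarrow> w x < top"
    by eventually_elim (auto simp: infinity_ennreal_def less_top)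
qed

lemma wmeasure_eq_0_iff:
  assumes [measurable]: "w \<in> borel_measurable lebesgue" "E \<in> sets lebesgue"
  shows "wmeasure w E = 0 \<longleftrightarrow> (AE x in lebesgue. x \<in> E \<longrightarrow> w x = 0)"
  unfolding wmeasure_def by (subst nn_integral_0_iff_AE) (auto simp: indicator_def)

lemma emeasure_lebesgue_ball_pos_finite:
  fixes x :: "real ^ 'n"
  assumes "0 < r"
  shows "0 < emeasure lebesgue (ball x r)" "emeasure lebesgue (ball x r) < top"
  unfolding emeasure_lebesgue_ball[OF assms] using assms by simp_all

lemma AE_ball_nonempty:
  fixes c :: "real ^ 'n"
  assumes "AE x in lebesgue. P x" "0 < R"
  shows "\<exists>x\<in>ball c R. P x"
proof (rule ccontr)
  assume "\<not> ?thesis"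
  with assms(1) have "AE x in lebesgue. x \<notin> ball c R" by (auto elim: eventually_mono)
  then have "emeasure lebesgue (ball c R) = 0"
    by (subst (asm) AE_iff_measurable[of "ball c R"]) (simp_all add: ball_def)
  then show False
    using emeasure_lebesgue_ball_pos_finite(1)[OF assms(2), of c] by simp
qed

lemma dual_weight_measurable [measurable]:
  "w \<in> borel_measurable lebesgue \<Longrightarrow> dual_weight r w \<in> borel_measurable lebesgue"
  unfolding dual_weight_def[abs_def] by measurable

lemma conj_exponent_minus: "1 < r \<Longrightarrow> 1 - conj_exponent r = - 1 / (r - 1)"
  by (simp add: conj_exponent_def field_simps)

section \<open>The \<open>Ap\<close> condition on a single ball and its consequences\<close>

lemma Ap_ball_le:
  fixes w :: "real ^ 'n \<Rightarrow> ennreal"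
  assumes r: "1 < r" and R: "0 < R"
  shows "wmeasure w (ball x R) / emeasure lebesgue (ball x R) *
     epowr (wmeasure (dual_weight r w) (ball x R) / emeasure lebesgue (ball x R)) (r - 1) \<le> Ap_const r w"
proof -
  have "average (ball x R) w * epowr (average (ball x R) (\<lambda>x. epowr (w x) (1 - conj_exponent r))) (r - 1)
     \<le> (SUP B\<in>balls. average B w * epowr (average B (\<lambda>x. epowr (w x) (1 - conj_exponent r))) (r - 1))"
    by (rule SUP_upper) (use R in \<open>auto simp: balls_def\<close>)
  then show ?thesis
    using r by (simp add: Ap_const_def average_def wmeasure_def dual_weight_def)
qed

text \<open>Where \<open>w\<close> vanishes, \<open>epowr\<close> with a negative exponent is
  \<open>top\<close>, so the dual weight is infinite almost everywhere on a ball of positive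
  volume.\<close>

lemma dual_weight_top_on_null:
  assumes [measurable]: "w \<in> borel_measurable lebesgue" and r: "1 < r" and R: "0 < R"
    and null: "wmeasure w (ball x R) = 0"
  shows "wmeasure (dual_weight r w) (ball x R) = top"
proof -
  have "AE y in lebesgue. y \<in> ball x R \<longrightarrow> w y = 0"
    using null by (simp add: wmeasure_eq_0_iff)
  then have "wmeasure (dual_weight r w) (ball x R) = (\<integral>\<^sup>+y. top * indicator (ball x R) y \<partial>lebesgue)"
    unfolding wmeasure_def
    by (intro nn_integral_cong_AE, eventually_elim)
       (use r in \<open>auto simp: indicator_def dual_weight_def epowr_def conj_exponent_minus\<close>)
  also have "\<dots> = top"
    using emeasure_lebesgue_ball_pos_finite(1)[OF R, of x]
    by (subst nn_integral_cmult_indicator) (auto simp: ennreal_top_mult)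
  finally show ?thesis .
qed

text \<open>Every ball containing \<open>y\<close> competes in \<open>maximal w y\<close>, so the
  essential supremum controls its average by a multiple of \<open>w y\<close> for almost every
  \<open>y\<close>.\<close>

lemma A1_ball_le:
  fixes w :: "real ^ 'n \<Rightarrow> ennreal"
  assumes w: "w \<in> Ap 1" and R: "0 < R"
  shows "AE y in lebesgue. y \<in> ball x R \<longrightarrow>
     w y < top \<and> wmeasure w (ball x R) / emeasure lebesgue (ball x R) \<le> Ap_const 1 w * w y"
proof -
  have [measurable]: "w \<in> borel_measurable lebesgue" and fin: "\<And>x R. wmeasure w (ball x R) < top"
    using w by (auto simp: Ap_def weight_def wmeasure_def)
  have wfin: "AE x in lebesgue. w x < top"
    by (rule weight_AE_finite) (use fin in auto)
  have K: "Ap_const 1 w < top" using w by (simp add: Ap_def)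
  have "AE y in lebesgue. maximal w y / w y \<le> Ap_const 1 w"
    unfolding Ap_const_def by simp (rule esssup_AE)
  with wfin show ?thesis
  proof eventually_elim
    case (elim y)
    show ?case
    proof
      assume y: "y \<in> ball x R"
      have "maximal w y \<le> Ap_const 1 w * w y"
      \<comment> \<open>At a zero of \<open>w\<close> the quotient is \<open>top\<close> unless the
        maximal function is also 0; finiteness of the constant leaves only the latter.\<close>
      proof (cases "w y = 0")
        case True
        then have "maximal w y = 0" using elim K
          by (cases "maximal w y = 0") (auto simp: ennreal_divide_zero top_unique)
        then show ?thesis by simp
      next
        case False
        have "maximal w y = maximal w y / w y * w y"
          using False elim by (simp add: ennreal_divide_times mult_divide_eq_ennreal)
        also have "\<dots> \<le> Ap_const 1 w * w y" by (intro mult_right_mono elim) simp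
        finally show ?thesis .
      qed
      then show "w y < top \<and> wmeasure w (ball x R) / emeasure lebesgue (ball x R) \<le> Ap_const 1 w * w y"
        using average_le_maximal[OF R y, of w] elim
        by (auto simp: average_def wmeasure_def intro: order_trans)
    qed
  qed
qed

text \<open>Both balls lie in one of radius \<open>T\<close>. If \<open>r > 1\<close>, its dual mass
  is infinite, and a finite constant forces the average of \<open>w\<close> to be 0; if
  \<open>r = 1\<close>, the pointwise bound is read at a point of the null ball. Thus either all
  balls have mass 0 or all have positive mass, the case distinction of the final proof.\<close>

lemma Ap_null_ball:
  fixes w :: "real ^ 'n \<Rightarrow> ennreal"
  assumes w: "w \<in> Ap r" and r: "1 \<le> r" and R: "0 < R" and S: "0 < S" and null: "wmeasure w (ball x R) = 0"
  shows "wmeasure w (ball y S) = 0"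
proof -
  have [measurable]: "w \<in> borel_measurable lebesgue" using w by (simp add: Ap_def weight_def)
  define T where "T = dist x y + R + S"
  have T: "0 < T" using R S by (simp add: T_def add_nonneg_pos)
  have sub: "ball x R \<subseteq> ball x T" "ball y S \<subseteq> ball x T"
    using R S by (auto simp: T_def ball_subset_ball_iff dist_commute add.commute subset_ball)
  note vol = emeasure_lebesgue_ball_pos_finite(2)[OF T, THEN less_imp_neq, of x]
  have "wmeasure w (ball x T) / emeasure lebesgue (ball x T) = 0"
  proof (cases "r = 1")
    case True
    have "AE z in lebesgue. z \<in> ball x R \<longrightarrow> w z = 0"
      using null by (simp add: wmeasure_eq_0_iff)
    with A1_ball_le[OF w[unfolded True] T, of x]
    have "AE z in lebesgue. z \<in> ball x R \<longrightarrow> wmeasure w (ball x T) / emeasure lebesgue (ball x T) = 0"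
      by eventually_elim (use sub(1) in auto)
    from AE_ball_nonempty[OF this R] show ?thesis by blast
  next
    case False
    then have r1: "1 < r" using r by simp
    have "top \<le> wmeasure (dual_weight r w) (ball x T)"
      using wmeasure_mono[OF sub(1), of "dual_weight r w"] dual_weight_top_on_null[OF _ r1 R null] by simp
    then have "wmeasure (dual_weight r w) (ball x T) = top" by (simp add: top_unique)
    moreover have "Ap_const r w < top" using w by (simp add: Ap_def)
    ultimately have "wmeasure w (ball x T) / emeasure lebesgue (ball x T) * top < top"
      using Ap_ball_le[OF r1 T, of w x] r1 vol
      by (simp add: ennreal_top_divide epowr_top)
    then show ?thesis
      by (auto simp: ennreal_mult_top split: if_splits)
  qed
  then have "wmeasure w (ball x T) = 0"
    using vol by (auto simp: ennreal_divide_eq_0_iff)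
  then show ?thesis
    using wmeasure_mono[OF sub(2), of w] by simp
qed

text \<open>All dual masses are infinite, and division by \<open>top\<close> gives 0 in
  \<open>ennreal\<close>, even for \<open>top / top\<close>. The equation for the exponent then
  reduces to \<open>1 / q = 1 / p\<close>.\<close>

lemma Ap_degenerate:
  fixes w :: "real ^ 'n \<Rightarrow> ennreal"
  assumes w: "w \<in> Ap r" and r: "1 < r" and R: "0 < R" and null: "wmeasure w (ball x R) = 0"
  shows "Ainf_const (dual_weight r w) = 0"
proof -
  have wm: "w \<in> borel_measurable lebesgue" using w by (simp add: Ap_def weight_def)
  have "wmeasure (dual_weight r w) (ball y S) = top" if S: "0 < S" for y S
    using dual_weight_top_on_null[OF wm r S] Ap_null_ball[OF w _ R S null] r by simp
  then have "Ainf_const (dual_weight r w) \<le> 0"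
    unfolding Ainf_const_def by (intro SUP_least) (auto simp: balls_def)
  then show ?thesis by simp
qed

text \<open>Since the averages of \<open>w\<close> are positive, an infinite dual mass would make
  the constant infinite. Finite dual mass excludes zeros of \<open>w\<close>, and finiteness of
  \<open>w\<close> excludes zeros of the dual weight, almost everywhere.\<close>

lemma Ap_nondegenerate:
  fixes w :: "real ^ 'n \<Rightarrow> ennreal"
  assumes w: "w \<in> Ap r" and r: "1 < r" and pos: "\<And>x R. 0 < R \<Longrightarrow> 0 < wmeasure w (ball x R)"
  shows "AE x in lebesgue. 0 < w x \<and> w x < top"
    and "wmeasure (dual_weight r w) (ball x R) < top"
    and "0 < R \<Longrightarrow> 0 < wmeasure (dual_weight r w) (ball x R)"
proof -
  have [measurable]: "w \<in> borel_measurable lebesgue" and fin: "\<And>x R. wmeasure w (ball x R) < top"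
    using w by (auto simp: Ap_def weight_def wmeasure_def)
  have wfin: "AE x in lebesgue. w x < top"
    by (rule weight_AE_finite) (use fin in auto)
  have \<sigma>fin': "wmeasure (dual_weight r w) (ball x R) < top" if R: "0 < R" for x R
  proof (rule ccontr)
    assume "\<not> ?thesis"
    then have "wmeasure (dual_weight r w) (ball x R) = top" by (metis top.not_eq_extremum)
    moreover have "Ap_const r w < top" using w by (simp add: Ap_def)
    ultimately have "wmeasure w (ball x R) / emeasure lebesgue (ball x R) * top < top"
      using Ap_ball_le[OF r R, of w x] r emeasure_lebesgue_ball_pos_finite(2)[OF R, THEN less_imp_neq, of x]
      by (simp add: ennreal_top_divide epowr_top)
    then have "wmeasure w (ball x R) / emeasure lebesgue (ball x R) = 0"
      by (auto simp: ennreal_mult_top split: if_splits)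
    then show False
      using emeasure_lebesgue_ball_pos_finite[OF R, of x] pos[OF R, of x]
      by (auto simp: ennreal_divide_eq_0_iff)
  qed
  show \<sigma>fin: "wmeasure (dual_weight r w) (ball x R) < top" for x R
    by (cases "0 < R") (use \<sigma>fin' in \<open>auto simp: wmeasure_def ball_empty\<close>)
  have "AE x in lebesgue. dual_weight r w x < top"
    by (rule weight_AE_finite) (use \<sigma>fin in auto)
  with wfin show AE: "AE x in lebesgue. 0 < w x \<and> w x < top"
  proof eventually_elim
    case (elim x)
    then show ?case using r by (cases "w x = 0") (auto simp: dual_weight_def epowr_def conj_exponent_minus zero_less_iff_neq_zero)
  qed
  show "0 < wmeasure (dual_weight r w) (ball x R)" if R: "0 < R"
  proof (rule ccontr)
    assume "\<not> ?thesis"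
    then have "AE y in lebesgue. y \<in> ball x R \<longrightarrow> dual_weight r w y = 0"
      by (simp add: wmeasure_eq_0_iff)
    with AE have "AE y in lebesgue. y \<notin> ball x R"
    proof eventually_elim
      case (elim y)
      then have "dual_weight r w y \<noteq> 0" using r
        by (auto simp: dual_weight_def epowr_neg_pos_finite conj_exponent_minus enn2real_eq_0_iff)
      then show ?case using elim by blast
    qed
    from AE_ball_nonempty[OF this R, of x] show False by auto
  qed
qed

subsection \<open>Integrals over small balls\<close>

text \<open>Allows powers of the constant to be handled as powers of a positive real. The unit ball
  is the test ball: a zero constant would contradict the positive averages there.\<close>

lemma Ap_const_pos:
  fixes w :: "real ^ 'n \<Rightarrow> ennreal"
  assumes w: "w \<in> Ap r" and r: "1 \<le> r" and pos: "\<And>x R. 0 < R \<Longrightarrow> 0 < wmeasure w (ball x R)"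
  shows "0 < enn2real (Ap_const r w)"
proof -
  have fin: "Ap_const r w < top" using w by (simp add: Ap_def)
  note vol = emeasure_lebesgue_ball_pos_finite[OF zero_less_one, of "0 :: real ^ 'n"]
  have avg: "0 < wmeasure v (ball 0 1) / emeasure lebesgue (ball (0 :: real ^ 'n) 1)"
    if "0 < wmeasure v (ball 0 1)" for v :: "real ^ 'n \<Rightarrow> ennreal"
    using that vol(2) by (simp add: zero_less_iff_neq_zero ennreal_divide_eq_0_iff less_top)
  have "Ap_const r w \<noteq> 0"
  proof (cases "r = 1")
    case True
    show ?thesis
    proof
      assume 0: "Ap_const r w = 0"
      have "AE y in lebesgue. y \<notin> ball (0 :: real ^ 'n) 1"
        using A1_ball_le[OF w[unfolded True] zero_less_one, of 0]
      proof eventually_elim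
        case (elim y)
        then show ?case
          using 0 True avg[OF pos[OF zero_less_one, of 0]] by auto
      qed
      from AE_ball_nonempty[OF this zero_less_one, of 0] show False by blast
    qed
  next
    case False
    then have r1: "1 < r" using r by simp
    have "wmeasure (dual_weight r w) (ball 0 1) / emeasure lebesgue (ball (0 :: real ^ 'n) 1) \<noteq> 0"
      using avg[THEN less_imp_neq] Ap_nondegenerate(3)[OF w r1 pos, of 1 0] by fastforce
    then have "epowr (wmeasure (dual_weight r w) (ball 0 1) / emeasure lebesgue (ball (0 :: real ^ 'n) 1)) (r - 1) \<noteq> 0"
      using r1 by (auto simp: epowr_def enn2real_eq_0_iff)
    then show ?thesis
      using Ap_ball_le[OF r1 zero_less_one, of w 0] avg[OF pos[OF zero_less_one, of 0]]
      by (metis bot.extremum_uniqueI bot_ennreal less_irrefl mult_eq_0_iff)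
  qed
  then show ?thesis using fin by (auto simp: enn2real_positive_iff zero_less_iff_neq_zero)
qed

text \<open>Here \<open>v\<close>, \<open>W\<close>, \<open>S\<close> are the volume, weight and
  dual mass of the large ball, \<open>t\<close> is the ratio of the radii, \<open>K\<close> the
  \<open>Ap\<close> constant and \<open>X\<close> a bound for the weighted integral. The
  \<open>Ap\<close> inequality trades \<open>S\<close> for \<open>K / W\<close>, after which the
  powers of \<open>v\<close> add up to one.\<close>

lemma Holder_constant_bound:
  fixes p r \<kappa> n t v W K X S :: real
  assumes r: "1 \<le> r" "r \<le> p" and pos: "0 < X" "0 < W" "0 < S" "0 < v" "0 < t" "0 < K"
    and Ap: "W / v * (S / v) powr (r - 1) \<le> K"
  shows "X powr (1 / p) * (2 * t powr (n * \<kappa>) * S) powr ((r - 1) / p) * (v * t powr n) powr (1 - r / p)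
     \<le> 2 * v * t powr (n * (1 - (r - \<kappa> * (r - 1)) / p)) * (K * X / W) powr (1 / p)"
proof -
  have p: "0 < p" using r by simp
  have "S powr ((r - 1) / p) = (v powr (r - 1) * (S / v) powr (r - 1)) powr (1 / p)"
    using pos by (simp add: powr_divide powr_powr)
  also have "\<dots> \<le> (v powr (r - 1) * (v * K / W)) powr (1 / p)"
    using Ap pos p by (intro powr_mono2 mult_left_mono) (auto simp: field_simps)
  also have "v powr (r - 1) * (v * K / W) = v powr r * (K / W)"
    using pos by (simp add: powr_diff)
  also have "(v powr r * (K / W)) powr (1 / p) = v powr (r / p) * (K / W) powr (1 / p)"
    using pos by (subst powr_mult) (auto simp: powr_powr)
  finally have S: "S powr ((r - 1) / p) \<le> v powr (r / p) * (K / W) powr (1 / p)" .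
  have two: "2 powr ((r - 1) / p) \<le> (2 :: real)"
    using powr_mono[of "(r - 1) / p" 1 "2 :: real"] r p by (simp add: field_simps)
  have "X powr (1 / p) * (2 * t powr (n * \<kappa>) * S) powr ((r - 1) / p) * (v * t powr n) powr (1 - r / p)
      = 2 powr ((r - 1) / p) * S powr ((r - 1) / p) *
        (X powr (1 / p) * t powr (n * \<kappa> * ((r - 1) / p)) * (v powr (1 - r / p) * t powr (n * (1 - r / p))))"
    using pos by (simp add: powr_mult powr_powr)
  also have "\<dots> \<le> 2 * (v powr (r / p) * (K / W) powr (1 / p)) *
        (X powr (1 / p) * t powr (n * \<kappa> * ((r - 1) / p)) * (v powr (1 - r / p) * t powr (n * (1 - r / p))))"
    using S two pos by (intro mult_right_mono mult_mono) auto
  also have "\<dots> = 2 * (v powr (r / p) * v powr (1 - r / p)) *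
        (t powr (n * \<kappa> * ((r - 1) / p)) * t powr (n * (1 - r / p))) *
        ((K / W) powr (1 / p) * X powr (1 / p))"
    by (simp only: ac_simps)
  also have "v powr (r / p) * v powr (1 - r / p) = v"
    using pos by (simp flip: powr_add)
  also have "t powr (n * \<kappa> * ((r - 1) / p)) * t powr (n * (1 - r / p)) = t powr (n * (1 - (r - \<kappa> * (r - 1)) / p))"
    using p unfolding powr_add[symmetric] by (intro arg_cong[of _ _ "(powr) t"]) (simp add: field_simps)
  also have "(K / W) powr (1 / p) * X powr (1 / p) = (K * X / W) powr (1 / p)"
    using pos powr_mult[of "K / W" X "1 / p"] by simp
  finally show ?thesis .
qed

text \<open>Hoelder is used on the small ball, decay moves the dual mass to the large ball, and the
  \<open>Ap\<close> condition is used only there, so the constant appears just once, to the power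
  \<open>1 / p\<close>.\<close>

lemma Ap_ball_integral_bound:
  fixes w :: "real ^ 'n \<Rightarrow> ennreal" and f :: "real ^ 'n \<Rightarrow> real"
  assumes w: "w \<in> Ap r" and r: "1 \<le> r" "r \<le> p" and pos: "\<And>x R. 0 < R \<Longrightarrow> 0 < wmeasure w (ball x R)"
    and f [measurable]: "f \<in> borel_measurable lebesgue" and f0: "\<And>x. 0 \<le> f x"
    and \<rho>: "0 < \<rho>" "\<rho> \<le> R"
    and decay: "1 < r \<Longrightarrow> enn2real (wmeasure (dual_weight r w) (ball x \<rho>))
        \<le> 2 * (\<rho> / R) powr (real CARD('n) * \<kappa>) * enn2real (wmeasure (dual_weight r w) (ball x R))"
    and X: "0 < X" "(\<integral>\<^sup>+y\<in>ball x \<rho>. (ennreal (f y powr p) * w y) \<partial>lebesgue) \<le> ennreal X"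
  shows "(\<integral>\<^sup>+y\<in>ball x \<rho>. ennreal (f y) \<partial>lebesgue)
     \<le> ennreal (2 * (unit_ball_vol (real CARD('n)) * R powr real CARD('n)) *
          (\<rho> / R) powr (real CARD('n) * (1 - (r - \<kappa> * (r - 1)) / p)) *
          (enn2real (Ap_const r w) * X / enn2real (wmeasure w (ball x R))) powr (1 / p))"
proof -
  let ?n = "real CARD('n)"
  define V where "V = unit_ball_vol ?n"
  define v where "v = V * R powr ?n"
  define t where "t = \<rho> / R"
  define K where "K = enn2real (Ap_const r w)"
  define W where "W = enn2real (wmeasure w (ball x R))"
  have [measurable]: "w \<in> borel_measurable lebesgue" and fin: "\<And>x R. wmeasure w (ball x R) < top"
    using w by (auto simp: Ap_def weight_def wmeasure_def)
  have R: "0 < R" and p: "1 \<le> p" using \<rho> r by auto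
  have V: "0 < V" by (simp add: V_def)
  have v: "0 < v" using V R by (simp add: v_def)
  have t: "0 < t" using \<rho> R by (simp add: t_def)
  have K: "0 < K" unfolding K_def by (rule Ap_const_pos[OF w r(1) pos])
  have W: "0 < W" using pos[OF R, of x] fin[of x R] by (simp add: W_def enn2real_positive_iff)
  have eK: "Ap_const r w = ennreal K" using w by (simp add: K_def Ap_def)
  have eW: "wmeasure w (ball x R) = ennreal W" using fin by (simp add: W_def)
  have ev: "emeasure lebesgue (ball x R) = ennreal v"
    unfolding v_def V_def by (rule emeasure_lebesgue_ball[OF R])
  have evt: "emeasure lebesgue (ball x \<rho>) = ennreal (v * t powr ?n)"
    unfolding emeasure_lebesgue_ball[OF \<rho>(1)] v_def t_def V_def[symmetric]
    using \<rho> R by (simp add: powr_divide)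
  have "(\<integral>\<^sup>+y\<in>ball x \<rho>. ennreal (f y) \<partial>lebesgue)
      \<le> ennreal (2 * v * t powr (?n * (1 - (r - \<kappa> * (r - 1)) / p)) * (K * X / W) powr (1 / p))"
  proof (cases "r = 1")
    case True
    \<comment> \<open>For \<open>r = 1\<close> the weight is at least \<open>W / (K * v)\<close>
      almost everywhere on the ball. It is replaced by this constant, and Hoelder is applied with
      both weights equal to 1; its middle factor then has exponent 0.\<close>
    define Y where "Y = K * v / W * X"
    have Y: "0 < Y" using K v W X by (simp add: Y_def)
    have "(\<integral>\<^sup>+y\<in>ball x \<rho>. ennreal (f y powr p * 1) \<partial>lebesgue)
       \<le> (\<integral>\<^sup>+y. ennreal (K * v / W) * (ennreal (f y powr p) * w y * indicator (ball x \<rho>) y) \<partial>lebesgue)"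
    proof (rule nn_integral_mono_AE)
      have sub: "ball x \<rho> \<subseteq> ball x R" using \<rho> by (rule_tac subset_ball)
      show "AE y in lebesgue. ennreal (f y powr p * 1) * indicator (ball x \<rho>) y
         \<le> ennreal (K * v / W) * (ennreal (f y powr p) * w y * indicator (ball x \<rho>) y)"
        using A1_ball_le[OF w[unfolded True] R, of x]
      proof eventually_elim
        case (elim y)
        show ?case
        proof (cases "y \<in> ball x \<rho>")
          case y: True
          then have "w y < top" "ennreal (W / v) \<le> ennreal K * w y"
            using elim sub W v by (auto simp: eW ev eK True[symmetric] divide_ennreal)
          then obtain s where s: "w y = ennreal s" "0 \<le> s" "W / v \<le> K * s"
            using K W v by (cases "w y") (auto simp flip: ennreal_mult)
          then have "1 \<le> K * v / W * s" using W v by (simp add: field_simps)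
          then have "f y powr p * 1 \<le> f y powr p * (K * v / W * s)" by (rule mult_left_mono) simp
          then show ?thesis
            using y s K v W by (simp add: ac_simps ennreal_leI flip: ennreal_mult)
        qed simp
      qed
    qed
    also have "\<dots> = ennreal (K * v / W) * (\<integral>\<^sup>+y\<in>ball x \<rho>. (ennreal (f y powr p) * w y) \<partial>lebesgue)"
      by (rule nn_integral_cmult) measurable
    also have "\<dots> \<le> ennreal (K * v / W) * ennreal X"
      by (rule mult_left_mono[OF X(2)]) simp
    also have "\<dots> = ennreal Y"
      unfolding Y_def using X K v W by (intro ennreal_mult[symmetric]) auto
    finally have Yle: "(\<integral>\<^sup>+y\<in>ball x \<rho>. ennreal (f y powr p * 1) \<partial>lebesgue) \<le> ennreal Y" .
    have "(\<integral>\<^sup>+y\<in>ball x \<rho>. ennreal (f y) \<partial>lebesgue)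
      \<le> ennreal (Y powr (1 / p) * (v * t powr ?n) powr ((1 - 1) / p) * (v * t powr ?n) powr (1 - 1 / p))"
      by (rule weighted_Holder_three[where w = "\<lambda>_. 1" and s = "\<lambda>_. 1"])
         (use f0 p Y v t Yle in \<open>simp_all add: evt\<close>)
    also have "\<dots> = ennreal (Y powr (1 / p) * (v * t powr ?n) powr (1 - 1 / p))"
      using v t by simp
    also have "\<dots> \<le> ennreal (2 * v * t powr (?n * (1 - (r - \<kappa> * (r - 1)) / p)) * (K * X / W) powr (1 / p))"
    proof (rule ennreal_leI)
      have "Y powr (1 / p) * (v * t powr ?n) powr (1 - 1 / p)
         = (v powr (1 / p) * v powr (1 - 1 / p)) * t powr (?n * (1 - 1 / p)) * (K * X / W) powr (1 / p)"
        using K v W X t powr_mult[of v "K * X / W" "1 / p"]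
        by (simp add: Y_def powr_mult powr_powr ac_simps)
      also have "v powr (1 / p) * v powr (1 - 1 / p) = v"
        using v by (simp flip: powr_add)
      also have "v * t powr (?n * (1 - 1 / p)) * (K * X / W) powr (1 / p)
          \<le> 2 * (v * t powr (?n * (1 - 1 / p)) * (K * X / W) powr (1 / p))"
        using v by simp
      finally show "Y powr (1 / p) * (v * t powr ?n) powr (1 - 1 / p)
          \<le> 2 * v * t powr (?n * (1 - (r - \<kappa> * (r - 1)) / p)) * (K * X / W) powr (1 / p)"
        by (simp add: True mult.assoc)
    qed
    finally show ?thesis .
  next
    case False
    then have r1: "1 < r" using r by simp
    have nd: "AE y in lebesgue. 0 < w y \<and> w y < top"
      "\<And>x R. wmeasure (dual_weight r w) (ball x R) < top"
      "\<And>x R. 0 < R \<Longrightarrow> 0 < wmeasure (dual_weight r w) (ball x R)"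
      by (rule Ap_nondegenerate[OF w r1 pos]; assumption)+
    define S where "S = enn2real (wmeasure (dual_weight r w) (ball x R))"
    have S: "0 < S" using nd(3)[OF R, of x] nd(2)[of x R] by (simp add: S_def enn2real_positive_iff)
    have eS: "wmeasure (dual_weight r w) (ball x R) = ennreal S" using nd(2) by (simp add: S_def)
    define g where "g y = enn2real (w y)" for y
    define s where "s y = enn2real (dual_weight r w y)" for y
    have [measurable]: "g \<in> borel_measurable lebesgue" "s \<in> borel_measurable lebesgue"
      unfolding g_def[abs_def] s_def[abs_def] by measurable
    have gs: "w y = ennreal (g y) \<and> dual_weight r w y = ennreal (s y) \<and>
        0 < g y \<and> s y = g y powr (- 1 / (r - 1))" if "0 < w y \<and> w y < top" for y
    proof -
      have "0 < g y" "w y = ennreal (g y)" using that by (auto simp: g_def enn2real_positive_iff)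
      moreover have d: "dual_weight r w y = ennreal (g y powr (- 1 / (r - 1)))"
        unfolding dual_weight_def conj_exponent_minus[OF r1] g_def
        using that r1 by (intro epowr_neg_pos_finite) auto
      moreover have "s y = g y powr (- 1 / (r - 1))" unfolding s_def d by simp
      ultimately show ?thesis by metis
    qed
    have dual: "AE y in lebesgue. 0 < g y \<and> 0 < s y \<and> g y * s y powr (r - 1) = 1"
      using nd(1)
    proof eventually_elim
      case (elim y)
      note g = gs[OF elim]
      then have sy: "s y = g y powr (- 1 / (r - 1))" by blast
      have "s y powr (r - 1) = 1 / g y"
        unfolding sy powr_powr using r1 g by (simp add: powr_neg_one)
      moreover have "0 < s y" unfolding sy using g by simp
      ultimately show ?case using g by simp
    qed
    have X': "(\<integral>\<^sup>+y\<in>ball x \<rho>. ennreal (f y powr p * g y) \<partial>lebesgue) \<le> ennreal X"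
    proof -
      have "(\<integral>\<^sup>+y\<in>ball x \<rho>. ennreal (f y powr p * g y) \<partial>lebesgue)
        = (\<integral>\<^sup>+y\<in>ball x \<rho>. (ennreal (f y powr p) * w y) \<partial>lebesgue)"
      proof (rule nn_integral_cong_AE)
        show "AE y in lebesgue. ennreal (f y powr p * g y) * indicator (ball x \<rho>) y
          = ennreal (f y powr p) * w y * indicator (ball x \<rho>) y"
          using nd(1)
        proof eventually_elim
          case (elim y)
          then have "w y = ennreal (g y)" "0 \<le> g y" using gs[OF elim] by simp_all
          then show ?case by (simp add: ennreal_mult)
        qed
      qed
      then show ?thesis using X by simp
    qed
    have Y': "(\<integral>\<^sup>+y\<in>ball x \<rho>. ennreal (s y) \<partial>lebesgue) \<le> ennreal (2 * t powr (?n * \<kappa>) * S)"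
    proof -
      have "(\<integral>\<^sup>+y\<in>ball x \<rho>. ennreal (s y) \<partial>lebesgue) = wmeasure (dual_weight r w) (ball x \<rho>)"
        unfolding wmeasure_def
      proof (rule nn_integral_cong_AE)
        show "AE y in lebesgue. ennreal (s y) * indicator (ball x \<rho>) y
          = dual_weight r w y * indicator (ball x \<rho>) y"
          using nd(1)
        proof eventually_elim
          case (elim y)
          then have "dual_weight r w y = ennreal (s y)" using gs[OF elim] by blast
          then show ?case by (simp only:)
        qed
      qed
      also have "\<dots> = ennreal (enn2real (wmeasure (dual_weight r w) (ball x \<rho>)))"
        using nd(2) by simp
      also have "\<dots> \<le> ennreal (2 * t powr (?n * \<kappa>) * S)"
        using decay[OF r1] by (intro ennreal_leI) (simp add: t_def S_def)
      finally show ?thesis .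
    qed
    have Ap: "W / v * (S / v) powr (r - 1) \<le> K"
    proof -
      have "ennreal (W / v * (S / v) powr (r - 1)) \<le> ennreal K"
        using Ap_ball_le[OF r1 R, of w x] W v S r1 unfolding eW ev eS eK
        by (subst ennreal_mult) (simp_all add: divide_ennreal epowr_ennreal)
      then show ?thesis using K by simp
    qed
    have "(\<integral>\<^sup>+y\<in>ball x \<rho>. ennreal (f y) \<partial>lebesgue)
      \<le> ennreal (X powr (1 / p) * (2 * t powr (?n * \<kappa>) * S) powr ((r - 1) / p) * (v * t powr ?n) powr (1 - r / p))"
      by (rule weighted_Holder_three[OF f _ _ _ dual f0 r X(1) _ _ X' Y'])
         (use t v S in \<open>simp_all add: evt\<close>)
    also have "\<dots> \<le> ennreal (2 * v * t powr (?n * (1 - (r - \<kappa> * (r - 1)) / p)) * (K * X / W) powr (1 / p))"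
      by (intro ennreal_leI Holder_constant_bound r X W S v t K Ap)
    finally show ?thesis .
  qed
  then show ?thesis by (simp only: v_def V_def t_def K_def W_def)
qed

subsection \<open>The level sets of the Riesz potential\<close>

lemma powr_le_one_plus:
  fixes x \<theta> :: real
  assumes "0 \<le> x" "0 \<le> \<theta>" "\<theta> \<le> 1"
  shows "x powr \<theta> \<le> 1 + x"
proof -
  have "x powr \<theta> \<le> (1 + x) powr \<theta>" using assms by (intro powr_mono2) auto
  also have "\<dots> \<le> (1 + x) powr 1" using assms by (intro powr_mono) auto
  finally show ?thesis using assms by simp
qed

text \<open>\<open>y\<close> is the relative weight of the level set and \<open>l\<close> the
  threshold for ball averages. Raising \<open>C5 * G / l\<close> to the power
  \<open>\<theta> = 1 - \<alpha> / a\<close> leaves exactly one factor \<open>1 / t\<close>, which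
  cancels \<open>t\<close>. The other constants carry exponents in the unit interval, hence bounds
  free of the exponents.\<close>

lemma level_optimisation:
  fixes t G R \<alpha> a P n C3 C4 C5 p Q y \<rho> l :: real
  assumes pos: "0 < t" "0 < G" "0 < R" "0 < C3" "0 < C4" "0 < C5" "0 < p"
    and \<alpha>: "0 < \<alpha>" "\<alpha> < a" "\<alpha> \<le> n" and n: "1 \<le> n" and P: "1 \<le> P"
    and \<rho>: "\<rho> = (2 * C3 * P * R powr a * G / t) powr (1 / (a - \<alpha>))"
    and l: "l = \<alpha> * t / (2 * C4 * \<rho> powr \<alpha>)"
    and y: "0 \<le> y" "y \<le> 1" "y \<le> (C5 * G / l) powr p"
    and Q: "(a - \<alpha>) / (a * p) \<le> Q"
  shows "t * y powr Q \<le> (1 + 2 * C4 * C5) * (1 + 2 * C3) * n / \<alpha> * P * R powr \<alpha> * G"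
proof -
  define \<theta> where "\<theta> = (a - \<alpha>) / a"
  define \<eta> where "\<eta> = \<alpha> / a"
  have \<theta>: "0 < \<theta>" "\<theta> \<le> 1" and \<eta>: "0 < \<eta>" "\<eta> \<le> 1" and sum: "\<theta> + \<eta> = 1"
    using \<alpha> by (auto simp: \<theta>_def \<eta>_def field_simps)
  define x1 where "x1 = 2 * C4 * C5"
  define x2 where "x2 = 2 * C3"
  have x: "0 < x1" "0 < x2" using pos by (auto simp: x1_def x2_def)
  have \<rho>0: "0 < \<rho>" unfolding \<rho> using pos P by simp
  \<comment> \<open>Dividing \<open>\<alpha> * \<theta>\<close> by \<open>a - \<alpha>\<close>
    leaves \<open>\<alpha> / a = \<eta>\<close>.\<close>
  have "\<rho> powr (\<alpha> * \<theta>) = (x2 * P * R powr a * G / t) powr \<eta>"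
    unfolding \<rho> x2_def powr_powr using \<alpha> by (intro arg_cong[of _ _ "(powr) _"]) (simp add: \<theta>_def \<eta>_def)
  moreover have "C5 * G / l = x1 * G / (\<alpha> * t) * \<rho> powr \<alpha>"
    using pos \<alpha> \<rho>0 by (simp add: l x1_def field_simps)
  ultimately have C5: "(C5 * G / l) powr \<theta> = (x1 * G / (\<alpha> * t)) powr \<theta> * (x2 * P * R powr a * G / t) powr \<eta>"
    using pos x \<alpha> \<rho>0 by (simp add: powr_mult powr_powr powr_divide)
  have l0: "0 < l" using pos \<alpha> \<rho>0 by (simp add: l)
  \<comment> \<open>Because \<open>y \<le> 1\<close>, lowering the exponent enlarges the
    power.\<close>
  have "y powr Q \<le> y powr (\<theta> / p)"
    using y Q by (intro powr_mono') (auto simp: \<theta>_def)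
  also have "\<dots> \<le> ((C5 * G / l) powr p) powr (\<theta> / p)"
    using y \<theta> pos by (intro powr_mono2) auto
  also have "\<dots> = (C5 * G / l) powr \<theta>"
    using pos by (simp add: powr_powr)
  finally have "t * y powr Q \<le> t * (C5 * G / l) powr \<theta>"
    using pos by simp
  also have "\<dots> = (t powr \<theta> * (x1 * G / (\<alpha> * t)) powr \<theta>) * (t powr \<eta> * (x2 * P * R powr a * G / t) powr \<eta>)"
  proof -
    have "t = t powr \<theta> * t powr \<eta>" using pos sum by (simp flip: powr_add)
    then have "t * (C5 * G / l) powr \<theta> = (t powr \<theta> * t powr \<eta>) * (C5 * G / l) powr \<theta>" by simp
    then show ?thesis unfolding C5 by (simp only: ac_simps)
  qed
  also have "t powr \<theta> * (x1 * G / (\<alpha> * t)) powr \<theta> = (x1 * (1 / \<alpha>) * G) powr \<theta>"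
    using pos x \<alpha> by (simp flip: powr_mult)
  also have "t powr \<eta> * (x2 * P * R powr a * G / t) powr \<eta> = (x2 * P * R powr a * G) powr \<eta>"
    using pos x P by (simp flip: powr_mult)
  also have "(x1 * (1 / \<alpha>) * G) powr \<theta> * (x2 * P * R powr a * G) powr \<eta>
      = (x1 powr \<theta> * x2 powr \<eta>) * (1 / \<alpha>) powr \<theta> * P powr \<eta> * (R powr a) powr \<eta> * (G powr \<theta> * G powr \<eta>)"
    using pos x P \<alpha> by (simp only: powr_mult ac_simps)
  also have "(R powr a) powr \<eta> = R powr \<alpha>"
    using \<alpha> by (simp add: powr_powr \<eta>_def)
  also have "G powr \<theta> * G powr \<eta> = G"
    using pos sum by (simp flip: powr_add)
  also have "(x1 powr \<theta> * x2 powr \<eta>) * (1 / \<alpha>) powr \<theta> * P powr \<eta> * R powr \<alpha> * G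
      \<le> ((1 + x1) * (1 + x2)) * (n / \<alpha>) * P * R powr \<alpha> * G"
  proof (intro mult_mono order.refl)
    show "x1 powr \<theta> \<le> 1 + x1" "x2 powr \<eta> \<le> 1 + x2"
      using x \<theta> \<eta> by (auto intro!: powr_le_one_plus)
    \<comment> \<open>\<open>1 / \<alpha>\<close> may be below 1, where raising the exponent to 1
      would go the wrong way; hence the detour through \<open>n / \<alpha> \<ge> 1\<close>.\<close>
    have "(1 / \<alpha>) powr \<theta> \<le> (n / \<alpha>) powr \<theta>"
      using n \<alpha> \<theta> by (intro powr_mono2 divide_right_mono) auto
    also have "\<dots> \<le> (n / \<alpha>) powr 1"
      using n \<alpha> \<theta> by (intro powr_mono) auto
    finally show "(1 / \<alpha>) powr \<theta> \<le> n / \<alpha>" using n \<alpha> by simp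
    show "P powr \<eta> \<le> P"
      using powr_mono[of \<eta> 1 P] P \<eta> by simp
  qed (use pos x n \<alpha> P in auto)
  finally show ?thesis by (simp add: x1_def x2_def)
qed

lemma ennreal_less_topE:
  assumes "A < (top :: ennreal)"
  obtains a where "A = ennreal a" "0 \<le> a"
  using assms by (cases A) auto

lemma nn_integral_off_support:
  assumes "\<And>y. y \<notin> B \<Longrightarrow> g y = 0" "B \<subseteq> C"
  shows "(\<integral>\<^sup>+y\<in>C. g y \<partial>M) = (\<integral>\<^sup>+y. g y \<partial>M)"
  using assms by (intro nn_integral_cong) (auto simp: indicator_def)

text \<open>Enlarging the ball in the weight by a fixed factor costs nothing because the \<open>Ap\<close>
  condition is applied on the enlarged ball; this keeps the power of the constant equal to one.\<close>

lemma Ap_large_average_ball: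
  fixes w :: "real ^ 'n \<Rightarrow> ennreal" and f :: "real ^ 'n \<Rightarrow> real"
  assumes w: "w \<in> Ap r" and r: "1 \<le> r" "r \<le> p" and pos: "\<And>x R. 0 < R \<Longrightarrow> 0 < wmeasure w (ball x R)"
    and f [measurable]: "f \<in> borel_measurable lebesgue" and f0: "\<And>x. 0 \<le> f x"
    and s: "0 < s" and l: "0 < l"
    and J: "(\<integral>\<^sup>+y\<in>ball x s. (ennreal (f y powr p) * w y) \<partial>lebesgue) < top"
    and large: "ennreal (l * s powr real CARD('n)) < (\<integral>\<^sup>+y\<in>ball x s. ennreal (f y) \<partial>lebesgue)"
  shows "wmeasure w (ball x (6 * s))
     \<le> ennreal ((2 * unit_ball_vol (real CARD('n)) * 6 ^ CARD('n) / l) powr p * enn2real (Ap_const r w)) *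
        (\<integral>\<^sup>+y\<in>ball x s. (ennreal (f y powr p) * w y) \<partial>lebesgue)"
proof -
  let ?n = "real CARD('n)"
  define C where "C = 2 * unit_ball_vol ?n * 6 ^ CARD('n)"
  define K where "K = enn2real (Ap_const r w)"
  define W where "W = enn2real (wmeasure w (ball x (6 * s)))"
  have fin: "\<And>x R. wmeasure w (ball x R) < top"
    using w by (auto simp: Ap_def weight_def wmeasure_def)
  have s6: "0 < 6 * s" and p: "1 \<le> p" using s r by auto
  have C: "0 < C" by (simp add: C_def)
  have K: "0 < K" unfolding K_def by (rule Ap_const_pos[OF w r(1) pos])
  have W: "0 < W" using pos[OF s6, of x] fin[of x "6 * s"] by (simp add: W_def enn2real_positive_iff)
  have eW: "wmeasure w (ball x (6 * s)) = ennreal W" using fin by (simp add: W_def)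
  obtain j where j: "(\<integral>\<^sup>+y\<in>ball x s. (ennreal (f y powr p) * w y) \<partial>lebesgue) = ennreal j" "0 \<le> j"
    by (rule ennreal_less_topE[OF J])
  define c where "c = (C / l) powr p * K"
  have c: "0 < c" using C l K by (simp add: c_def)
  \<comment> \<open>The integral bound is stated for positive \<open>X\<close>, while
    \<open>j\<close> may be 0; the passage from all such \<open>X\<close> to \<open>j\<close> is
    made by density below.\<close>
  have W_le: "W \<le> c * X" if X: "0 < X" "j \<le> X" for X
  proof -
    \<comment> \<open>With \<open>\<kappa> = 0\<close> the decay is plain monotonicity of the dual
      mass.\<close>
    have decay: "enn2real (wmeasure (dual_weight r w) (ball x s))
        \<le> 2 * (s / (6 * s)) powr (?n * 0) * enn2real (wmeasure (dual_weight r w) (ball x (6 * s)))"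
      if "1 < r"
    proof -
      have "wmeasure (dual_weight r w) (ball x (6 * s)) < top"
        by (rule Ap_nondegenerate[OF w that pos])
      then have "enn2real (wmeasure (dual_weight r w) (ball x s)) \<le> enn2real (wmeasure (dual_weight r w) (ball x (6 * s)))"
        using s by (intro enn2real_mono wmeasure_mono subset_ball) auto
      moreover have "0 \<le> enn2real (wmeasure (dual_weight r w) (ball x (6 * s)))" by simp
      ultimately have "enn2real (wmeasure (dual_weight r w) (ball x s))
          \<le> 2 * enn2real (wmeasure (dual_weight r w) (ball x (6 * s)))" by linarith
      then show ?thesis using s by simp
    qed
    have "ennreal (l * s powr ?n) \<le> ennreal (2 * (unit_ball_vol ?n * (6 * s) powr ?n) *
          (s / (6 * s)) powr (?n * (1 - (r - 0 * (r - 1)) / p)) * (K * X / W) powr (1 / p))"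
      unfolding K_def W_def
      by (rule order_trans[OF less_imp_le[OF large] Ap_ball_integral_bound[OF w r pos f f0 s _ decay X(1)]])
         (use s j X in \<open>simp_all add: ennreal_leI\<close>)
    then have "l * s powr ?n \<le> 2 * (unit_ball_vol ?n * (6 * s) powr ?n) *
          (s / (6 * s)) powr (?n * (1 - (r - 0 * (r - 1)) / p)) * (K * X / W) powr (1 / p)"
      by (subst (asm) ennreal_le_iff) auto
    also have "\<dots> \<le> 2 * (unit_ball_vol ?n * (6 * s) powr ?n) * 1 * (K * X / W) powr (1 / p)"
      using s r p by (intro mult_right_mono mult_left_mono powr_le1) (auto simp: divide_le_eq)
    also have "\<dots> = s powr ?n * (C * (K * X / W) powr (1 / p))"
      using s by (simp add: C_def powr_mult powr_realpow)
    finally have "l \<le> C * (K * X / W) powr (1 / p)"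
      using s by (simp add: mult.commute[of _ "s powr _"])
    then have "1 \<le> C / l * (K * X / W) powr (1 / p)"
      using l by (simp add: field_simps)
    then have "1 \<le> (C / l * (K * X / W) powr (1 / p)) powr p"
      using p by (intro ge_one_powr_ge_zero) auto
    also have "\<dots> = (C / l) powr p * (K * X / W)"
      using C l K X W p by (subst powr_mult) (auto simp: powr_powr)
    finally show ?thesis using W by (simp add: c_def field_simps)
  qed
  have "W \<le> c * j"
  proof (rule ccontr)
    assume "\<not> ?thesis"
    then have lt: "j < W / c" using c by (simp add: field_simps)
    then obtain X where X: "j < X" "X < W / c" using dense by blast
    then have "W \<le> c * X" using j(2) by (intro W_le) auto
    then show False using X c by (simp add: less_divide_eq mult.commute)
  qed
  then have "ennreal W \<le> ennreal c * ennreal j"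
    using c j by (simp add: ennreal_leI flip: ennreal_mult)
  then show ?thesis unfolding eW j(1) c_def C_def K_def .
qed

text \<open>Splitting the kernel at \<open>\<rho>\<close> produces a ball with large average around
  each point of \<open>E\<close>; the Vitali bound controls the weight of \<open>E\<close> by a
  power of \<open>l\<close>, and \<open>level_optimisation\<close> removes \<open>t\<close>.
  \<open>f\<close> stands for an absolute value, and \<open>X\<close> is any positive upper bound,
  so that a vanishing integral can be reached as a limit.\<close>

lemma riesz_level_set_bound:
  fixes w :: "real ^ 'n \<Rightarrow> ennreal" and f :: "real ^ 'n \<Rightarrow> real"
  assumes \<alpha>: "0 < \<alpha>" "\<alpha> < real CARD('n)" and p: "p < real CARD('n) / \<alpha>"
    and w: "w \<in> Ap r" and r: "1 \<le> r" "r \<le> p" and pos: "\<And>x R. 0 < R \<Longrightarrow> 0 < wmeasure w (ball x R)"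
    and f [measurable]: "f \<in> borel_measurable lebesgue" and f0: "\<And>x. 0 \<le> f x"
    and R: "0 < R" and supp: "\<And>y. y \<notin> ball x0 R \<Longrightarrow> f y = 0"
    and \<kappa>: "0 \<le> \<kappa>" "\<kappa> \<le> 1"
    and decay: "\<And>x \<rho> S. 1 < r \<Longrightarrow> 0 < \<rho> \<Longrightarrow> \<rho> \<le> S \<Longrightarrow>
        enn2real (wmeasure (dual_weight r w) (ball x \<rho>))
        \<le> 2 * (\<rho> / S) powr (real CARD('n) * \<kappa>) * enn2real (wmeasure (dual_weight r w) (ball x S))"
    and X: "0 < X" "(\<integral>\<^sup>+y. (ennreal (f y powr p) * w y) \<partial>lebesgue) \<le> ennreal X"
    and Q: "1 / p - \<alpha> / (real CARD('n) * (r - \<kappa> * (r - 1))) \<le> Q"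
    and t: "0 < t" and E: "E \<subseteq> ball x0 R"
    and level: "\<And>x. x \<in> E \<Longrightarrow>
        ennreal t < (\<integral>\<^sup>+y. ennreal (f y) * ennreal (1 / norm (x - y) powr (real CARD('n) - \<alpha>)) \<partial>lebesgue)"
  defines "C4 \<equiv> 2 ^ CARD('n) * (2 * (1 + real CARD('n)))"
    and "V \<equiv> unit_ball_vol (real CARD('n))"
  shows "t * (enn2real (wmeasure w E / wmeasure w (ball x0 R))) powr Q
     \<le> (1 + 2 * C4 * (2 * V * 6 ^ CARD('n))) * (1 + 2 * (C4 * (2 ^ (CARD('n) + 1) * V))) * real CARD('n) / \<alpha> *
        sobolev_exponent (real CARD('n)) \<alpha> p * R powr \<alpha> *
        (enn2real (Ap_const r w) * X / enn2real (wmeasure w (ball x0 R))) powr (1 / p)"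
proof -
  let ?n = "real CARD('n)"
  define K where "K = enn2real (Ap_const r w)"
  define W where "W = enn2real (wmeasure w (ball x0 R))"
  define G where "G = (K * X / W) powr (1 / p)"
  define s where "s = r - \<kappa> * (r - 1)"
  define a where "a = ?n * s / p"
  define P where "P = sobolev_exponent ?n \<alpha> p"
  define C5 where "C5 = 2 * V * 6 ^ CARD('n)"
  define C3 where "C3 = C4 * (2 ^ (CARD('n) + 1) * V)"
  define D where "D = 2 ^ (CARD('n) + 1) * V * R powr a * G"
  have wm [measurable]: "w \<in> borel_measurable lebesgue" and fin: "\<And>x R. wmeasure w (ball x R) < top"
    using w by (auto simp: Ap_def weight_def wmeasure_def)
  have n: "1 \<le> ?n" by (simp add: Suc_le_eq)
  have p1: "1 \<le> p" using r by simp
  have V: "0 < V" by (simp add: V_def)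
  have C: "0 < C4" "0 < C5" "0 < C3" using V by (auto simp: C4_def C5_def C3_def add_pos_nonneg)
  have K: "0 < K" unfolding K_def by (rule Ap_const_pos[OF w r(1) pos])
  have W: "0 < W" using pos[OF R, of x0] fin[of x0 R] by (simp add: W_def enn2real_positive_iff)
  have eW: "wmeasure w (ball x0 R) = ennreal W" using fin by (simp add: W_def)
  have G: "0 < G" using K X W by (simp add: G_def)
  have Gp: "G powr p = K * X / W" using K X W p1 by (simp add: G_def powr_powr)
  have s: "1 \<le> s" "s \<le> r"
    using mult_right_mono[OF \<kappa>(2), of "r - 1"] mult_nonneg_nonneg[OF \<kappa>(1), of "r - 1"] r by (auto simp: s_def)
  have \<alpha>p: "\<alpha> * p < ?n" using p \<alpha> by (simp add: field_simps)
  have a: "?n / p \<le> a" "a \<le> ?n"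
    using s r p1 by (auto simp: a_def field_simps)
  have \<alpha>a: "\<alpha> < a" 
    using less_le_trans[OF _ a(1), of \<alpha>] \<alpha>p p1 by (simp add: less_divide_eq)
  have P: "1 \<le> P"
  proof -
    have "?n \<le> ?n * p" "0 \<le> \<alpha> * p" using p1 \<alpha> by simp_all
    then have "?n - \<alpha> * p \<le> ?n * p" by linarith
    then show ?thesis using \<alpha>p by (simp add: P_def sobolev_exponent_def)
  qed
  \<comment> \<open>The Sobolev exponent enters here: \<open>a \<ge> n / p\<close> limits
    \<open>1 / (a - \<alpha>)\<close>, the size of the far series.\<close>
  have inv_b: "1 / (a - \<alpha>) \<le> P"
  proof -
    have "1 / (a - \<alpha>) \<le> 1 / (?n / p - \<alpha>)"
      using a \<alpha>a \<alpha>p p1 by (intro divide_left_mono mult_pos_pos) (auto simp: less_divide_eq)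
    also have "\<dots> = p / (?n - \<alpha> * p)" using p1 by (simp add: field_simps)
    also have "\<dots> \<le> ?n * p / (?n - \<alpha> * p)"
      using \<alpha>p p1 n by (intro divide_right_mono) auto
    finally show ?thesis by (simp add: P_def sobolev_exponent_def)
  qed
  have D: "0 < D" using V R G by (simp add: D_def)
  \<comment> \<open>The reference ball is \<open>ball x (2 * R)\<close>; it contains the support, so
    its weight is at least \<open>W\<close>.\<close>
  have mass_small: "(\<integral>\<^sup>+y\<in>ball x \<tau>. ennreal (f y) \<partial>lebesgue) \<le> ennreal (D * \<tau> powr (?n - a))"
    if x: "x \<in> ball x0 R" and \<tau>: "0 < \<tau>" "\<tau> \<le> 2 * R" for x \<tau>
  proof -
    have sub: "ball x0 R \<subseteq> ball x (2 * R)"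
      using x R by (auto simp: ball_subset_ball_iff dist_commute)
    have X': "(\<integral>\<^sup>+y\<in>ball x \<tau>. (ennreal (f y powr p) * w y) \<partial>lebesgue) \<le> ennreal X"
      by (rule order_trans[OF _ X(2)]) (auto intro!: nn_integral_mono simp: indicator_def)
    let ?W = "enn2real (wmeasure w (ball x (2 * R)))"
    have WW: "W \<le> ?W"
      unfolding W_def using fin by (intro enn2real_mono wmeasure_mono sub) auto
    have "(\<integral>\<^sup>+y\<in>ball x \<tau>. ennreal (f y) \<partial>lebesgue) \<le> ennreal (2 * (V * (2 * R) powr ?n) *
          (\<tau> / (2 * R)) powr (?n * (1 - s / p)) * (K * X / ?W) powr (1 / p))"
      unfolding K_def V_def s_def
      by (rule Ap_ball_integral_bound[OF w r pos f f0 \<tau> decay X(1) X']) (use \<tau> in auto)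
    also have "\<dots> \<le> ennreal (2 * (V * (2 * R) powr ?n) * (\<tau> / (2 * R)) powr (?n * (1 - s / p)) * G)"
      unfolding G_def using V K X W WW p1
      by (intro ennreal_leI mult_left_mono powr_mono2 divide_left_mono) auto
    also have "\<dots> \<le> ennreal (D * \<tau> powr (?n - a))"
    proof (rule ennreal_leI)
      have ex: "?n * (1 - s / p) = ?n - a" using p1 by (simp add: a_def field_simps)
      have "(2 * R) powr ?n * (\<tau> / (2 * R)) powr (?n - a) = (2 * R) powr a * \<tau> powr (?n - a)"
        using R \<tau> by (simp add: powr_divide powr_diff)
      also have "(2 * R) powr a = 2 powr a * R powr a" using R by (simp add: powr_mult)
      finally have eq: "(2 * R) powr ?n * (\<tau> / (2 * R)) powr (?n - a) = 2 powr a * (R powr a * \<tau> powr (?n - a))"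
        by simp
      have "(2 :: real) powr a \<le> 2 powr ?n" using a by (intro powr_mono) auto
      then have two: "(2 :: real) powr a \<le> 2 ^ CARD('n)" by (simp add: powr_realpow)
      have "2 * (V * (2 * R) powr ?n) * (\<tau> / (2 * R)) powr (?n * (1 - s / p)) * G
        = 2 * V * G * ((2 * R) powr ?n * (\<tau> / (2 * R)) powr (?n - a))"
        unfolding ex by (simp only: ac_simps)
      also have "\<dots> \<le> 2 * V * G * (2 ^ CARD('n) * (R powr a * \<tau> powr (?n - a)))"
        unfolding eq using V G two by (intro mult_left_mono mult_right_mono) auto
      finally show "2 * (V * (2 * R) powr ?n) * (\<tau> / (2 * R)) powr (?n * (1 - s / p)) * G \<le> D * \<tau> powr (?n - a)"
        by (simp add: D_def ac_simps)
    qed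
    finally show ?thesis .
  qed
  \<comment> \<open>Beyond radius \<open>2 * R\<close> the support is exhausted and the integral
    stays constant, while the bound is monotone because \<open>a \<le> n\<close>.\<close>
  have mass: "(\<integral>\<^sup>+y\<in>ball x \<tau>. ennreal (f y) \<partial>lebesgue) \<le> ennreal (D * \<tau> powr (?n - a))"
    if x: "x \<in> ball x0 R" and \<tau>: "0 < \<tau>" for x \<tau>
  proof (cases "\<tau> \<le> 2 * R")
    case True
    then show ?thesis using mass_small x \<tau> by blast
  next
    case False
    have sub: "ball x0 R \<subseteq> ball x (2 * R)"
      using x R by (auto simp: ball_subset_ball_iff dist_commute)
    have "(\<integral>\<^sup>+y\<in>ball x \<tau>. ennreal (f y) \<partial>lebesgue) \<le> (\<integral>\<^sup>+y. ennreal (f y) \<partial>lebesgue)"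
      by (auto intro!: nn_integral_mono simp: indicator_def)
    also have "\<dots> = (\<integral>\<^sup>+y\<in>ball x (2 * R). ennreal (f y) \<partial>lebesgue)"
      by (rule nn_integral_off_support[symmetric, OF _ sub]) (simp add: supp)
    also have "\<dots> \<le> ennreal (D * (2 * R) powr (?n - a))"
      using R by (intro mass_small x) auto
    also have "\<dots> \<le> ennreal (D * \<tau> powr (?n - a))"
      using False D R a by (intro ennreal_leI mult_left_mono powr_mono2) auto
    finally show ?thesis .
  qed
  \<comment> \<open>\<open>\<rho>\<close> is chosen to make the far part at most
    \<open>t / 2\<close>; afterwards \<open>l\<close> makes the near bound equal to
    \<open>t / 2\<close>.\<close>
  define \<rho> where "\<rho> = (2 * C3 * P * R powr a * G / t) powr (1 / (a - \<alpha>))"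
  have \<rho>: "0 < \<rho>" using C P R G t by (simp add: \<rho>_def)
  have \<rho>b: "\<rho> powr (a - \<alpha>) = 2 * C3 * P * R powr a * G / t"
    unfolding \<rho>_def powr_powr using \<alpha>a C P R G t by simp
  define l where "l = \<alpha> * t / (2 * C4 * \<rho> powr \<alpha>)"
  have l: "0 < l" using \<alpha> t C \<rho> by (simp add: l_def)
  have large: "\<exists>\<tau>. 0 < \<tau> \<and> \<tau> \<le> \<rho> \<and> ennreal (l * \<tau> powr ?n) < (\<integral>\<^sup>+y\<in>ball x \<tau>. ennreal (f y) \<partial>lebesgue)"
    if x: "x \<in> E" for x
  proof (rule ccontr)
    assume "\<not> ?thesis"
    then have small: "(\<integral>\<^sup>+y\<in>ball x \<tau>. ennreal (f y) \<partial>lebesgue) \<le> ennreal (l * \<tau> powr ?n)"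
      if "0 < \<tau>" "\<tau> \<le> \<rho>" for \<tau> using that by (meson not_le)
    let ?k = "\<lambda>y. ennreal (f y) * ennreal (1 / norm (x - y) powr (?n - \<alpha>))"
    have "(\<integral>\<^sup>+y\<in>ball x \<rho>. ?k y \<partial>lebesgue) \<le> ennreal (2 ^ CARD('n) * l * (\<rho> powr \<alpha> * (2 * (1 + ?n) / \<alpha>)))"
      by (rule riesz_kernel_near) (use \<alpha> \<rho> l small in auto)
    also have "2 ^ CARD('n) * l * (\<rho> powr \<alpha> * (2 * (1 + ?n) / \<alpha>)) = C4 * l * \<rho> powr \<alpha> / \<alpha>"
      by (simp add: C4_def)
    also have "\<dots> = t / 2"
      using \<alpha> \<rho> C unfolding l_def by simp
    finally have near: "(\<integral>\<^sup>+y\<in>ball x \<rho>. ?k y \<partial>lebesgue) \<le> ennreal (t / 2)" .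
    have "(\<integral>\<^sup>+y\<in>- ball x \<rho>. ?k y \<partial>lebesgue)
       \<le> ennreal (2 ^ CARD('n) * D * (\<rho> powr (\<alpha> - a) * (2 * (1 + ?n) / (a - \<alpha>))))"
      by (rule riesz_kernel_far) (use \<alpha> \<alpha>a a \<rho> D mass x E in auto)
    also have "\<dots> \<le> ennreal (t / 2)"
    proof (rule ennreal_leI)
      have "2 ^ CARD('n) * D * (\<rho> powr (\<alpha> - a) * (2 * (1 + ?n) / (a - \<alpha>)))
         = C4 * D * \<rho> powr (\<alpha> - a) * (1 / (a - \<alpha>))"
        by (simp add: C4_def)
      also have "\<dots> \<le> C4 * D * \<rho> powr (\<alpha> - a) * P"
        using inv_b C D by (intro mult_left_mono) auto
      also have "\<dots> = (C3 * P * R powr a * G) / \<rho> powr (a - \<alpha>)"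
        using powr_minus_divide[of \<rho> "a - \<alpha>"] by (simp add: C3_def D_def)
      also have "\<dots> = t / 2"
        unfolding \<rho>b using C P R G t by simp
      finally show "2 ^ CARD('n) * D * (\<rho> powr (\<alpha> - a) * (2 * (1 + ?n) / (a - \<alpha>))) \<le> t / 2" .
    qed
    finally have far: "(\<integral>\<^sup>+y\<in>- ball x \<rho>. ?k y \<partial>lebesgue) \<le> ennreal (t / 2)" .
    have meas_k [measurable]: "?k \<in> borel_measurable lebesgue"
    proof -
      have "(\<lambda>y. 1 / norm (x - y) powr (?n - \<alpha>)) \<in> borel_measurable lborel" by measurable
      then have [measurable]: "(\<lambda>y. 1 / norm (x - y) powr (?n - \<alpha>)) \<in> borel_measurable lebesgue"
        by (rule measurable_completion)
      show ?thesis by measurable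
    qed
    have "(\<integral>\<^sup>+y. ?k y \<partial>lebesgue) = (\<integral>\<^sup>+y. (?k y * indicator (ball x \<rho>) y + ?k y * indicator (- ball x \<rho>) y) \<partial>lebesgue)"
      by (intro nn_integral_cong) (auto simp: indicator_def)
    also have "\<dots> = (\<integral>\<^sup>+y\<in>ball x \<rho>. ?k y \<partial>lebesgue) + (\<integral>\<^sup>+y\<in>- ball x \<rho>. ?k y \<partial>lebesgue)"
      by (rule nn_integral_add) measurable
    also have "\<dots> \<le> ennreal (t / 2) + ennreal (t / 2)" by (intro add_mono near far)
    also have "\<dots> = ennreal t" using t by (simp flip: ennreal_plus)
    finally show False using level[OF x] by simp
  qed
  define g where "g y = ennreal (f y powr p) * w y" for y
  have gm: "g \<in> borel_measurable lebesgue" unfolding g_def[abs_def] by measurable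
  define c where "c = (C5 / l) powr p * K"
  have c: "0 < c" using C l K by (simp add: c_def)
  have "wmeasure w E \<le> ennreal c * (\<integral>\<^sup>+y. g y \<partial>lebesgue)"
  proof (rule Vitali_weak_type[OF wm gm])
    fix x assume "x \<in> E"
    then obtain \<tau> where \<tau>: "0 < \<tau>" "\<tau> \<le> \<rho>"
      and lt: "ennreal (l * \<tau> powr ?n) < (\<integral>\<^sup>+y\<in>ball x \<tau>. ennreal (f y) \<partial>lebesgue)"
      using large by blast
    have "(\<integral>\<^sup>+y\<in>ball x \<tau>. (ennreal (f y powr p) * w y) \<partial>lebesgue) \<le> ennreal X"
      by (rule order_trans[OF _ X(2)]) (auto intro!: nn_integral_mono simp: indicator_def)
    then have J: "(\<integral>\<^sup>+y\<in>ball x \<tau>. (ennreal (f y powr p) * w y) \<partial>lebesgue) < top"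
      by (rule le_less_trans) simp
    have "wmeasure w (ball x (6 * \<tau>)) \<le> ennreal c * (\<integral>\<^sup>+y\<in>ball x \<tau>. g y \<partial>lebesgue)"
      unfolding c_def C5_def K_def V_def g_def
      by (rule Ap_large_average_ball[OF w r pos f f0 \<tau>(1) l J lt])
    then show "\<exists>s>0. s \<le> \<rho> \<and> wmeasure w (ball x (6 * s)) \<le> ennreal c * (\<integral>\<^sup>+y\<in>ball x s. g y \<partial>lebesgue)"
      using \<tau> by blast
  qed
  also have "\<dots> \<le> ennreal c * ennreal X"
    unfolding g_def by (rule mult_left_mono[OF X(2)]) simp
  also have "\<dots> = ennreal (c * X)" using c X by (simp add: ennreal_mult)
  finally have wE: "wmeasure w E \<le> ennreal (c * X)" .
  have wE_W: "wmeasure w E \<le> ennreal W" unfolding eW[symmetric] by (rule wmeasure_mono[OF E])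
  then obtain e where e: "wmeasure w E = ennreal e" "0 \<le> e"
    by (metis ennreal_less_top le_less_trans ennreal_less_topE)
  have eE: "e \<le> c * X" "e \<le> W" using wE wE_W c X W unfolding e(1) by simp_all
  have y: "enn2real (wmeasure w E / wmeasure w (ball x0 R)) = e / W"
    using e W by (simp add: eW divide_ennreal)
  have "e / W \<le> c * X / W" using eE W by (intro divide_right_mono) auto
  also have "\<dots> = (C5 / l) powr p * G powr p" by (simp add: c_def Gp)
  also have "\<dots> = (C5 * G / l) powr p" using C l G by (simp flip: powr_mult)
  finally have y1: "e / W \<le> (C5 * G / l) powr p" .
  \<comment> \<open>The identity \<open>a * p = n * s\<close> matches this with the assumed lower
    bound on \<open>Q\<close>.\<close>
  have Q': "(a - \<alpha>) / (a * p) \<le> Q"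
  proof -
    have "a * p = ?n * s" using p1 by (simp add: a_def)
    have "(a - \<alpha>) / (a * p) = 1 / p - \<alpha> / (a * p)"
      using \<alpha>a \<alpha> p1 by (simp add: diff_divide_distrib)
    then show ?thesis using Q unfolding \<open>a * p = ?n * s\<close> by (simp add: s_def)
  qed
  have "t * (e / W) powr Q \<le> (1 + 2 * C4 * C5) * (1 + 2 * C3) * ?n / \<alpha> * P * R powr \<alpha> * G"
    by (rule level_optimisation[OF t G R C(3) C(1) C(2) _ \<alpha>(1) \<alpha>a _ n P \<rho>_def l_def _ _ y1 Q'])
       (use p1 \<alpha> e W eE in auto)
  then show ?thesis
    unfolding y G_def C3_def C5_def P_def K_def W_def .
qed

subsection \<open>The weak-type estimate\<close>

text \<open>Points where the integral fails to converge absolutely are harmless, since the Bochner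
  integral is 0 there; elsewhere this is the triangle inequality. Level sets are thereby controlled
  by the potential of the absolute value.\<close>

lemma riesz_potential_le_nn_integral:
  fixes f :: "real ^ 'n \<Rightarrow> real"
  shows "ennreal \<bar>riesz_potential \<alpha> f x\<bar>
     \<le> (\<integral>\<^sup>+y. ennreal \<bar>f y\<bar> * ennreal (1 / norm (x - y) powr (real CARD('n) - \<alpha>)) \<partial>lebesgue)"
proof (cases "integrable lebesgue (\<lambda>y. f y / norm (x - y) powr (real CARD('n) - \<alpha>))")
  case True
  have "ennreal \<bar>riesz_potential \<alpha> f x\<bar>
      \<le> (\<integral>\<^sup>+y. ennreal (norm (f y / norm (x - y) powr (real CARD('n) - \<alpha>))) \<partial>lebesgue)"
    using integral_norm_bound_ennreal[OF True] by (simp add: riesz_potential_def)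
  also have "\<dots> = (\<integral>\<^sup>+y. ennreal \<bar>f y\<bar> * ennreal (1 / norm (x - y) powr (real CARD('n) - \<alpha>)) \<partial>lebesgue)"
    by (intro nn_integral_cong) (simp flip: ennreal_mult)
  finally show ?thesis .
next
  case False
  then show ?thesis by (simp add: riesz_potential_def not_integrable_integral_eq)
qed

text \<open>The limit of \<open>X\<close> to 0, for functions whose weighted integral
  vanishes.\<close>

lemma le_zero_from_powr_bound:
  fixes z M p :: real
  assumes "0 < p" "0 \<le> M" and le: "\<And>X. 0 < X \<Longrightarrow> z \<le> M * X powr (1 / p)"
  shows "z \<le> 0"
proof (rule ccontr)
  assume "\<not> ?thesis"
  then have z: "0 < z" by simp
  define N where "N = M + 1"
  have N: "0 < N" using assms by (simp add: N_def)
  define u where "u = z / N / 2"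
  have u: "0 < u" using z N by (simp add: u_def)
  have "z \<le> M * (u powr p) powr (1 / p)" using u by (intro le) simp
  also have "\<dots> = M * u" using u assms by (simp add: powr_powr)
  also have "\<dots> < N * (2 * u)" unfolding N_def using u assms by (intro mult_strict_mono') auto
  also have "\<dots> = z" using N by (simp add: u_def)
  finally show False by simp
qed

text \<open>If the \<open>A\<^sub>\<infinity>\<close> constant of the dual weight is infinite, \<open>enn2real\<close> turns it into \<open>0\<close>,
  so that \<open>q = p\<close>; the decay exponent \<open>\<kappa> = 0\<close> then suffices.\<close>

lemma exponent_decay_choice:
  fixes w :: "real ^ 'n \<Rightarrow> ennreal"
  assumes \<alpha>: "0 < \<alpha>" "\<alpha> < real CARD('n)" and p: "1 \<le> p" "p < real CARD('n) / \<alpha>"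
    and r: "1 \<le> r" "r \<le> p" and w: "w \<in> Ap r"
    and pos: "\<And>x R. 0 < R \<Longrightarrow> 0 < wmeasure w (ball x R)"
    and q: "if r = 1 then q = sobolev_exponent (real CARD('n)) \<alpha> p
       else (let \<tau> = 2 ^ (CARD('n) + 1); A = enn2real (Ainf_const (dual_weight r w))
             in 1 / p - 1 / q = \<alpha> / real CARD('n) * ((\<tau> * A) / (1 + r * (\<tau> * A - 1))))"
  obtains \<kappa> where "0 \<le> \<kappa>" "\<kappa> \<le> 1"
    "\<And>x \<rho> S. 1 < r \<Longrightarrow> 0 < \<rho> \<Longrightarrow> \<rho> \<le> S \<Longrightarrow>
        enn2real (wmeasure (dual_weight r w) (ball x \<rho>))
        \<le> 2 * (\<rho> / S) powr (real CARD('n) * \<kappa>) * enn2real (wmeasure (dual_weight r w) (ball x S))"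
    "1 / p - \<alpha> / (real CARD('n) * (r - \<kappa> * (r - 1))) \<le> 1 / q"
proof -
  let ?n = "real CARD('n)"
  show ?thesis
  proof (cases "r = 1")
    case True
    \<comment> \<open>For \<open>r = 1\<close> the factor \<open>r - 1\<close> removes
      \<open>\<kappa>\<close>, and the Sobolev exponent gives equality.\<close>
    have "1 / p - \<alpha> / ?n = 1 / q"
      using q True \<alpha> p by (simp add: sobolev_exponent_def diff_divide_distrib)
    then show ?thesis using that[of 0] True by simp
  next
    case False
    then have r1: "1 < r" using r by simp
    have nd: "\<And>x R. wmeasure (dual_weight r w) (ball x R) < top"
      "\<And>x R. 0 < R \<Longrightarrow> 0 < wmeasure (dual_weight r w) (ball x R)"
      by (rule Ap_nondegenerate[OF w r1 pos]; assumption)+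
    define A where "A = enn2real (Ainf_const (dual_weight r w))"
    define T where "T = 2 ^ (CARD('n) + 1) * A"
    have q': "1 / p - 1 / q = \<alpha> / ?n * (T / (1 + r * (T - 1)))"
      using q False by (simp add: Let_def T_def A_def)
    show ?thesis
    proof (cases "Ainf_const (dual_weight r w) < top")
      case True
      have Ainf: "1 \<le> A"
        "\<And>x \<rho> S. 0 < \<rho> \<Longrightarrow> \<rho> \<le> S \<Longrightarrow> enn2real (wmeasure (dual_weight r w) (ball x \<rho>))
           \<le> 2 * (\<rho> / S) powr (?n / (2 ^ (CARD('n) + 1) * A)) * enn2real (wmeasure (dual_weight r w) (ball x S))"
        unfolding A_def by (rule Ainf_ball_decay[OF nd(2,1) True]; assumption)+
      have "2 * 1 \<le> (2 ^ CARD('n) :: real) * A"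
        using power_increasing[of 1 "CARD('n)" "2::real"] Ainf(1) by (intro mult_mono) (auto simp: Suc_le_eq)
      then have T: "4 \<le> T" by (simp add: T_def mult.commute)
      show ?thesis
      proof (rule that)
        show "0 \<le> 1 / T" "1 / T \<le> 1" using T by auto
        show "enn2real (wmeasure (dual_weight r w) (ball x \<rho>))
          \<le> 2 * (\<rho> / S) powr (?n * (1 / T)) * enn2real (wmeasure (dual_weight r w) (ball x S))"
          if "0 < \<rho>" "\<rho> \<le> S" for x \<rho> S
          using Ainf(2)[OF that, of x] by (simp add: T_def)
        \<comment> \<open>This identity turns the exponent obtained from
          \<open>\<kappa> = 1 / T\<close> into the formula defining \<open>q\<close>, so the
          required inequality holds with equality.\<close>
        have "r - 1 / T * (r - 1) = (1 + r * (T - 1)) / T"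
          using T by (simp add: field_simps)
        then have "\<alpha> / (?n * (r - 1 / T * (r - 1))) = \<alpha> / ?n * (T / (1 + r * (T - 1)))"
          by simp
        then show "1 / p - \<alpha> / (?n * (r - 1 / T * (r - 1))) \<le> 1 / q"
          using q' by linarith
      qed
    next
      case False
      then have "A = 0" by (simp add: A_def top.not_eq_extremum[symmetric])
      then have "1 / q = 1 / p" using q' by (simp add: T_def)
      show ?thesis
      proof (rule that)
        show "(0 :: real) \<le> 0" "(0 :: real) \<le> 1" by auto
        show "enn2real (wmeasure (dual_weight r w) (ball x \<rho>))
          \<le> 2 * (\<rho> / S) powr (?n * 0) * enn2real (wmeasure (dual_weight r w) (ball x S))"
          if "0 < \<rho>" "\<rho> \<le> S" for x \<rho> S
        proof -
          have "enn2real (wmeasure (dual_weight r w) (ball x \<rho>)) \<le> enn2real (wmeasure (dual_weight r w) (ball x S))"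
            using that nd(1) by (intro enn2real_mono wmeasure_mono subset_ball) auto
          then have "enn2real (wmeasure (dual_weight r w) (ball x \<rho>)) \<le> 2 * enn2real (wmeasure (dual_weight r w) (ball x S))"
            using enn2real_nonneg[of "wmeasure (dual_weight r w) (ball x S)"] by linarith
          then show ?thesis using that by simp
        qed
        show "1 / p - \<alpha> / (?n * (r - 0 * (r - 1))) \<le> 1 / q"
          unfolding \<open>1 / q = 1 / p\<close> using \<alpha> r by simp
      qed
    qed
  qed
qed

text \<open>\<open>0 / 0 = 0\<close> in \<open>ennreal\<close> and \<open>epowr\<close> sends 0 to 0
  for a positive exponent, so every term of the supremum vanishes.\<close>

lemma weak_average_null_weight:
  fixes w :: "real ^ 'n \<Rightarrow> ennreal"
  assumes "wmeasure w B = 0" "0 < 1 / q"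
  shows "weak_average q B w g = 0"
proof -
  have "wmeasure w {x \<in> B. \<bar>g x\<bar> > t} = 0" for t
    using wmeasure_mono[of "{x \<in> B. \<bar>g x\<bar> > t}" B w] assms by (auto simp: subset_iff)
  then have "weak_average q B w g \<le> 0"
    unfolding weak_average_def using assms by (intro SUP_least) (simp add: epowr_def)
  then show ?thesis by simp
qed

theorem theorem2p3:
  shows "\<exists>c::real. c > 0 \<and>
    (\<forall>(\<alpha>::real) (p::real) (r::real) (q::real) (w :: real ^ 'n \<Rightarrow> ennreal).
      0 < \<alpha> \<and> \<alpha> < real CARD('n) \<and>
      1 \<le> p \<and> p < real CARD('n) / \<alpha> \<and>
      1 \<le> r \<and> r \<le> p \<and>
      w \<in> Ap r \<and>
      (if r = 1 then q = sobolev_exponent (real CARD('n)) \<alpha> p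
       else (let \<tau> = 2 ^ (CARD('n) + 1); A = enn2real (Ainf_const (dual_weight r w))
             in 1 / p - 1 / q = \<alpha> / real CARD('n) * ((\<tau> * A) / (1 + r * (\<tau> * A - 1)))))
      \<longrightarrow> (\<forall>(x0 :: real ^ 'n) (R::real) (f :: real ^ 'n \<Rightarrow> real).
            R > 0 \<and> f \<in> weighted_Lp p (ball x0 R) w \<longrightarrow>
            weak_average q (ball x0 R) w (riesz_potential \<alpha> (zero_extension (ball x0 R) f))
            \<le> ennreal (c / \<alpha> * sobolev_exponent (real CARD('n)) \<alpha> p) *
               epowr (Ap_const r w) (1 / p) *
               ennreal (R powr \<alpha>) *
               epowr ((\<integral>\<^sup>+ x \<in> ball x0 R. ennreal (\<bar>f x\<bar> powr p) * w x \<partial>lebesgue)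
                      / wmeasure w (ball x0 R)) (1 / p)))"
proof -
  define C4 where "C4 = 2 ^ CARD('n) * (2 * (1 + real CARD('n)))"
  define V where "V = unit_ball_vol (real CARD('n))"
  \<comment> \<open>The constant of \<open>riesz_level_set_bound\<close>, built from the dimension
    alone.\<close>
  define c where "c = (1 + 2 * C4 * (2 * V * 6 ^ CARD('n))) * (1 + 2 * (C4 * (2 ^ (CARD('n) + 1) * V))) * real CARD('n)"
  have V: "0 \<le> V" and C4: "0 \<le> C4" by (auto simp: V_def C4_def)
  have c: "0 < c" unfolding c_def using V C4 by (intro mult_pos_pos add_pos_nonneg) auto
  show ?thesis
  proof (intro exI[of _ c] conjI c allI impI, elim conjE)
    fix \<alpha> p r q :: real and w :: "real ^ 'n \<Rightarrow> ennreal" and x0 :: "real ^ 'n" and R :: real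
      and f :: "real ^ 'n \<Rightarrow> real"
    assume \<alpha>: "0 < \<alpha>" "\<alpha> < real CARD('n)" and p: "1 \<le> p" "p < real CARD('n) / \<alpha>"
      and r: "1 \<le> r" "r \<le> p" and w: "w \<in> Ap r"
      and q: "if r = 1 then q = sobolev_exponent (real CARD('n)) \<alpha> p
       else (let \<tau> = 2 ^ (CARD('n) + 1); A = enn2real (Ainf_const (dual_weight r w))
             in 1 / p - 1 / q = \<alpha> / real CARD('n) * ((\<tau> * A) / (1 + r * (\<tau> * A - 1))))"
      and R: "0 < R" and f: "f \<in> weighted_Lp p (ball x0 R) w"
    let ?n = "real CARD('n)"
    let ?B = "ball x0 R"
    define P where "P = sobolev_exponent ?n \<alpha> p"
    define h where "h = zero_extension ?B f"
    define J where "J = (\<integral>\<^sup>+ x \<in> ?B. ennreal (\<bar>f x\<bar> powr p) * w x \<partial>lebesgue)"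
    have \<alpha>p: "\<alpha> * p < ?n" using p \<alpha> by (simp add: field_simps)
    have P: "0 < P" using \<alpha>p p by (simp add: P_def sobolev_exponent_def)
    have hm [measurable]: "h \<in> borel_measurable lebesgue" and Jfin: "J < top"
      using f by (simp_all add: weighted_Lp_def h_def J_def)
    show "weak_average q ?B w (riesz_potential \<alpha> h) \<le> ennreal (c / \<alpha> * P) *
        epowr (Ap_const r w) (1 / p) * ennreal (R powr \<alpha>) * epowr (J / wmeasure w ?B) (1 / p)"
    proof (cases "wmeasure w ?B = 0")
      case True
      \<comment> \<open>\<open>q\<close> is known only through its equation. For
        \<open>r > 1\<close> a null weight has \<open>Ainf_const\<close> of the dual equal to 0, so
        \<open>1 / q = 1 / p\<close>.\<close>
      have "0 < 1 / q"
      proof (cases "r = 1")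
        case True
        then show ?thesis using q P by (simp add: P_def)
      next
        case False
        then have "Ainf_const (dual_weight r w) = 0"
          using Ap_degenerate[OF w _ R True] r by simp
        then show ?thesis using q False p by simp
      qed
      from weak_average_null_weight[OF True this] show ?thesis by simp
    next
      case False
      have pos: "0 < wmeasure w (ball x S)" if S: "0 < S" for x S
        using Ap_null_ball[OF w r(1) S R, of x x0] False by (auto simp: zero_less_iff_neq_zero)
      have fin: "\<And>x R. wmeasure w (ball x R) < top"
        using w by (auto simp: Ap_def weight_def wmeasure_def)
      define K where "K = enn2real (Ap_const r w)"
      define W where "W = enn2real (wmeasure w ?B)"
      have K: "0 < K" unfolding K_def by (rule Ap_const_pos[OF w r(1) pos])
      have W: "0 < W" using pos[OF R, of x0] fin[of x0 R] by (simp add: W_def enn2real_positive_iff)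
      have eK: "Ap_const r w = ennreal K" using w by (simp add: K_def Ap_def)
      have eW: "wmeasure w ?B = ennreal W" using fin by (simp add: W_def)
      obtain j where j: "J = ennreal j" "0 \<le> j" by (rule ennreal_less_topE[OF Jfin])
      obtain \<kappa> where \<kappa>: "0 \<le> \<kappa>" "\<kappa> \<le> 1"
        and decay: "\<And>x \<rho> S. 1 < r \<Longrightarrow> 0 < \<rho> \<Longrightarrow> \<rho> \<le> S \<Longrightarrow>
          enn2real (wmeasure (dual_weight r w) (ball x \<rho>))
          \<le> 2 * (\<rho> / S) powr (?n * \<kappa>) * enn2real (wmeasure (dual_weight r w) (ball x S))"
        and Q: "1 / p - \<alpha> / (?n * (r - \<kappa> * (r - 1))) \<le> 1 / q"
      proof (rule exponent_decay_choice[OF \<alpha> p r w pos q], goal_cases)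
        case (2 \<kappa>)
        show ?case by (rule 2(1)[OF 2(2-)])
      qed
      \<comment> \<open>Positivity lets \<open>epowr\<close> be replaced by \<open>powr\<close>; it
        follows from \<open>r - \<kappa> * (r - 1) \<ge> 1\<close> and
        \<open>\<alpha> * p < n\<close>.\<close>
      have Q0: "0 < 1 / q"
      proof -
        have "0 \<le> (1 - \<kappa>) * (r - 1)" using \<kappa> r by simp
        then have s: "1 \<le> r - \<kappa> * (r - 1)" by (simp add: algebra_simps)
        have "\<alpha> / (?n * (r - \<kappa> * (r - 1))) \<le> \<alpha> / ?n"
          using s \<alpha> by (intro divide_left_mono) auto
        also have "\<dots> < 1 / p" using \<alpha>p p by (simp add: field_simps)
        finally show ?thesis using Q by linarith
      qed
      have J_h: "(\<integral>\<^sup>+y. (ennreal (\<bar>h y\<bar> powr p) * w y) \<partial>lebesgue) = J"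
        unfolding J_def by (intro nn_integral_cong) (auto simp: h_def zero_extension_def indicator_def)
      define M where "M = c / \<alpha> * P * R powr \<alpha> * (K / W) powr (1 / p)"
      have M: "0 \<le> M" using c \<alpha> P by (simp add: M_def)
      have bound: "ennreal t * epowr (wmeasure w {x \<in> ?B. \<bar>riesz_potential \<alpha> h x\<bar> > t} / wmeasure w ?B) (1 / q)
          \<le> ennreal (M * j powr (1 / p))" if t: "0 < t" for t
      proof -
        define E where "E = {x \<in> ?B. \<bar>riesz_potential \<alpha> h x\<bar> > t}"
        define y where "y = enn2real (wmeasure w E / wmeasure w ?B)"
        have E: "E \<subseteq> ?B" by (auto simp: E_def)
        have "wmeasure w E \<le> ennreal W" unfolding eW[symmetric] by (rule wmeasure_mono[OF E])
        then have "wmeasure w E < top" by (rule le_less_trans) simp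
        then obtain e where "wmeasure w E = ennreal e" "0 \<le> e" by (rule ennreal_less_topE)
        then have ey: "wmeasure w E / wmeasure w ?B = ennreal y"
          using W by (simp add: y_def eW divide_ennreal)
        have level: "ennreal t < (\<integral>\<^sup>+z. ennreal \<bar>h z\<bar> * ennreal (1 / norm (x - z) powr (?n - \<alpha>)) \<partial>lebesgue)"
          if "x \<in> E" for x
        proof -
          have "ennreal t < ennreal \<bar>riesz_potential \<alpha> h x\<bar>"
            using that t by (simp add: E_def ennreal_less_iff)
          then show ?thesis by (rule less_le_trans[OF _ riesz_potential_le_nn_integral])
        qed
        have le: "t * y powr (1 / q) \<le> M * X powr (1 / p)" if X: "0 < X" "j \<le> X" for X
        proof -
          have "t * y powr (1 / q) \<le> c / \<alpha> * P * R powr \<alpha> * (K * X / W) powr (1 / p)"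
            unfolding c_def C4_def V_def P_def y_def K_def W_def
            by (rule riesz_level_set_bound[OF \<alpha> p(2) w r pos _ _ R _ \<kappa> decay X(1) _ Q t E level])
               (use X j J_h in \<open>auto simp: h_def[symmetric] ennreal_leI\<close>, simp add: h_def zero_extension_def)
          also have "(K * X / W) powr (1 / p) = (K / W) powr (1 / p) * X powr (1 / p)"
            using K W X powr_mult[of "K / W" X "1 / p"] by simp
          finally show ?thesis by (simp add: M_def mult.assoc)
        qed
        have "t * y powr (1 / q) \<le> M * j powr (1 / p)"
        \<comment> \<open>For \<open>j = 0\<close> the parameter \<open>X\<close> tends to 0;
          otherwise \<open>X = j\<close> is admissible.\<close>
        proof (cases "j = 0")
          case True
          then have "t * y powr (1 / q) \<le> 0"
            using p M le by (intro le_zero_from_powr_bound[of p M]) auto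
          then show ?thesis using M by (simp add: order_trans)
        next
          case False
          then show ?thesis using le[of j] j by simp
        qed
        then show ?thesis
          using t Q0 unfolding E_def[symmetric] ey
          by (simp add: epowr_ennreal y_def ennreal_leI flip: ennreal_mult)
      qed
      have "weak_average q ?B w (riesz_potential \<alpha> h) \<le> ennreal (M * j powr (1 / p))"
        unfolding weak_average_def by (rule SUP_least) (use bound in simp)
      also have "M * j powr (1 / p) = c / \<alpha> * P * K powr (1 / p) * R powr \<alpha> * (j / W) powr (1 / p)"
        using K W j by (simp add: M_def powr_divide)
      also have "ennreal \<dots> = ennreal (c / \<alpha> * P) * epowr (Ap_const r w) (1 / p) *
          ennreal (R powr \<alpha>) * epowr (J / wmeasure w ?B) (1 / p)"
      proof -
        have "epowr (Ap_const r w) (1 / p) = ennreal (K powr (1 / p))"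
          unfolding eK using p K by (intro epowr_ennreal) auto
        moreover have "epowr (J / wmeasure w ?B) (1 / p) = ennreal ((j / W) powr (1 / p))"
          unfolding eW j(1) using p j W by (simp add: divide_ennreal epowr_ennreal)
        moreover have "0 \<le> c / \<alpha> * P" using c \<alpha> P by simp
        ultimately show ?thesis by (simp only: ennreal_mult mult_nonneg_nonneg powr_ge_zero)
      qed
      finally show ?thesis .
    qed
  qed
qed

end
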